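(* Let $(u,v,p)$ be a smooth solution of the hydrostatic Euler equations on $\mathbb{R}\times[0,1]$, that is, $$u_t+uu_x+vu_y=-p_x,\qquad u_x+v_y=0,$$ with initial data $u(0,x,y)=u_0(x,y)$ and boundary condition $v(t,x,0)=v(t,x,1)=0$, where $u=u(t,x,y)$, $v=v(t,x,y)$ and $p=p(t,x)$. Suppose there exist a position $\hat{x}\in\mathbb{R}$ and a constant horizontal velocity $\hat{u}\in\mathbb{R}$ such that the initial data $u_0$ satisfies the following properties at $x=\hat{x}$: $$u_0(\hat{x},y)\equiv\hat{u}\ \text{ for all } y\in[0,1],\qquad u_{0xy}(\hat{x},0)=0,\qquad u_{0xyy}(\hat{x},y)<0\ \text{ for all } y\in(0,1).$$ Then there exists a finite time $T>0$ such that either $$\lim_{t\to T^-}\max\{\|u(t)\|_{L^\infty},\|p_x(t)\|_{L^\infty}\}=+\infty,$$ or $$\lim_{t\to T^-}u_x(t,X(t,\hat{x},1),1)=-\infty,$$ where $X(t,\hat{x},1)$ is the $x$-component of the characteristic starting from $(\hat{x},1)$.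
   Context: The unknowns are $u,v$ (functions of time $t$ and of $(x,y)\in\mathbb{R}\times[0,1]$) and $p$, which depends only on $(t,x)$. Subscripts denote partial derivatives, e.g. $u_{0xy}=\partial_x\partial_y u_0$ and $u_{0xyy}=\partial_x\partial_y^2u_0$. The $L^\infty$ norms are taken over the spatial variables at fixed time $t$. Characteristics: the functions $X(t,x_0,y_0)$ and $Y(t,x_0,y_0)$ are called the $x$-component and $y$-component of the characteristic starting from $(x_0,y_0)$ if they satisfy $\dot X=u(t,X,Y)$, $\dot Y=v(t,X,Y)$, $X(0,x_0,y_0)=x_0$, $Y(0,x_0,y_0)=y_0$, where the dot is $\frac{d}{dt}$.
   Formalization: If the smooth solution has a finite lifespan, it is assumed to be maximal and to be extendable whenever the max of the two norms does not tend to infinity and u_x, u_y stay bounded along characteristics from x = x̂; otherwise a solution cut short is a counterexample. *)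

theory Defs
  imports "HOL-Analysis.Analysis" "HOL-Probability.Essential_Supremum"
begin

(* Fields depend on (t, x, y) with x in R and y in [0,1]; values for y outside [0,1] or t < 0
   are irrelevant, so derivatives in t and y are taken within [0,\<infinity>) and [0,1]
   (one-sided at t = 0, y = 0 and y = 1). *)

definition dt :: "(real \<Rightarrow> real \<Rightarrow> real \<Rightarrow> real) \<Rightarrow> real \<Rightarrow> real \<Rightarrow> real \<Rightarrow> real" where
  "dt f t x y = vector_derivative (\<lambda>s. f s x y) (at t within {0..})"

definition dx :: "(real \<Rightarrow> real \<Rightarrow> real) \<Rightarrow> real \<Rightarrow> real \<Rightarrow> real" where
  "dx f x y = deriv (\<lambda>s. f s y) x"

definition dy :: "(real \<Rightarrow> real \<Rightarrow> real) \<Rightarrow> real \<Rightarrow> real \<Rightarrow> real" where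
  "dy f x y = vector_derivative (\<lambda>s. f x s) (at y within {0..1})"

definition time_dom :: "ereal \<Rightarrow> real set" where
  "time_dom Tm = {t. 0 \<le> t \<and> ereal t < Tm}"

(* C^infinity on [0,Tm) x R x [0,1] up to the boundary: D i j k is the (one-sided where
   necessary) partial derivative of order i in t, j in x and k in y; all of them exist and are
   jointly continuous. *)
definition smooth_on_strip :: "ereal \<Rightarrow> (real \<Rightarrow> real \<Rightarrow> real \<Rightarrow> real) \<Rightarrow> bool" where
  "smooth_on_strip Tm f \<longleftrightarrow>
    (\<exists>D :: nat \<Rightarrow> nat \<Rightarrow> nat \<Rightarrow> real \<Rightarrow> real \<Rightarrow> real \<Rightarrow> real.
      (\<forall>t\<in>time_dom Tm. \<forall>x. \<forall>y\<in>{0..1}. D 0 0 0 t x y = f t x y) \<and>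
      (\<forall>i j k. continuous_on (time_dom Tm \<times> UNIV \<times> {0..1}) (\<lambda>(t, x, y). D i j k t x y)) \<and>
      (\<forall>i j k. \<forall>t\<in>time_dom Tm. \<forall>x. \<forall>y\<in>{0..1}.
        ((\<lambda>s. D i j k s x y) has_real_derivative D (Suc i) j k t x y) (at t within {0..}) \<and>
        ((\<lambda>s. D i j k t s y) has_real_derivative D i (Suc j) k t x y) (at x) \<and>
        ((\<lambda>s. D i j k t x s) has_real_derivative D i j (Suc k) t x y) (at y within {0..1})))"

definition hydrostatic_euler ::
  "ereal \<Rightarrow> (real \<Rightarrow> real \<Rightarrow> real \<Rightarrow> real) \<Rightarrow> (real \<Rightarrow> real \<Rightarrow> real \<Rightarrow> real) \<Rightarrow> (real \<Rightarrow> real \<Rightarrow> real) \<Rightarrow> bool" where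
  "hydrostatic_euler Tm u v p \<longleftrightarrow>
    smooth_on_strip Tm u \<and> smooth_on_strip Tm v \<and> smooth_on_strip Tm (\<lambda>t x y. p t x) \<and>
    (\<forall>t\<in>time_dom Tm. \<forall>x. \<forall>y\<in>{0..1}.
      dt u t x y + u t x y * dx (u t) x y + v t x y * dy (u t) x y = - deriv (p t) x \<and>
      dx (u t) x y + dy (v t) x y = 0) \<and>
    (\<forall>t\<in>time_dom Tm. \<forall>x. v t x 0 = 0 \<and> v t x 1 = 0)"

definition characteristic ::
  "ereal \<Rightarrow> (real \<Rightarrow> real \<Rightarrow> real \<Rightarrow> real) \<Rightarrow> (real \<Rightarrow> real \<Rightarrow> real \<Rightarrow> real) \<Rightarrow> real \<Rightarrow> real
    \<Rightarrow> (real \<Rightarrow> real) \<Rightarrow> (real \<Rightarrow> real) \<Rightarrow> bool" where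
  "characteristic Tm u v x0 y0 X Y \<longleftrightarrow>
    X 0 = x0 \<and> Y 0 = y0 \<and>
    (\<forall>t\<in>time_dom Tm. Y t \<in> {0..1} \<and>
      (X has_real_derivative u t (X t) (Y t)) (at t within {0..}) \<and>
      (Y has_real_derivative v t (X t) (Y t)) (at t within {0..}))"

definition Linf_strip :: "(real \<Rightarrow> real \<Rightarrow> real) \<Rightarrow> ereal" where
  "Linf_strip f = esssup (restrict_space lborel (UNIV \<times> {0..1})) (\<lambda>(x, y). ereal \<bar>f x y\<bar>)"

definition Linf_line :: "(real \<Rightarrow> real) \<Rightarrow> ereal" where
  "Linf_line g = esssup lborel (\<lambda>x. ereal \<bar>g x\<bar>)"

definition norms_blow_up ::
  "real \<Rightarrow> (real \<Rightarrow> real \<Rightarrow> real \<Rightarrow> real) \<Rightarrow> (real \<Rightarrow> real \<Rightarrow> real) \<Rightarrow> bool" where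
  "norms_blow_up T u p \<longleftrightarrow>
    ((\<lambda>t. max (Linf_strip (u t)) (Linf_line (deriv (p t)))) \<longlongrightarrow> \<infinity>) (at_left T)"

(* The pressure is determined only up to a function of t, so it need not be continued by the
   same function. *)
definition extends_beyond ::
  "real \<Rightarrow> (real \<Rightarrow> real \<Rightarrow> real \<Rightarrow> real) \<Rightarrow> (real \<Rightarrow> real \<Rightarrow> real \<Rightarrow> real) \<Rightarrow> bool" where
  "extends_beyond S u v \<longleftrightarrow>
    (\<exists>S' > S. \<exists>u' v' p'. hydrostatic_euler (ereal S') u' v' p' \<and>
      (\<forall>t\<in>{0..<S}. \<forall>x. \<forall>y\<in>{0..1}. u' t x y = u t x y \<and> v' t x y = v t x y))"

(* Uniform bound for u_x and u_y along all characteristics issuing from the vertical segment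
   {xh} x [0,1], for as long as they exist before time S. *)
definition gradient_bounded_from ::
  "real \<Rightarrow> (real \<Rightarrow> real \<Rightarrow> real \<Rightarrow> real) \<Rightarrow> (real \<Rightarrow> real \<Rightarrow> real \<Rightarrow> real) \<Rightarrow> real \<Rightarrow> bool" where
  "gradient_bounded_from S u v xh \<longleftrightarrow>
    (\<exists>M. \<forall>y0\<in>{0..1}. \<forall>s\<in>{0<..S}. \<forall>X Y. characteristic (ereal s) u v xh y0 X Y \<longrightarrow>
      (\<forall>t\<in>{0..<s}. \<bar>dx (u t) (X t) (Y t)\<bar> \<le> M \<and> \<bar>dy (u t) (X t) (Y t)\<bar> \<le> M))"

(* The standing continuation convention for the lifespan S of a smooth solution: a breakdown at S
   is not caused by something unrelated to the norms of u, p_x and to the column of fluid that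
   starts above xh.  Maximality of the solution alone is too weak for the dichotomy: if (u,v,p) is
   a bounded solution on [0,S] and b(0) = b'(0) = 0, then u(t,x-b(t),y) + b'(t), v(t,x-b(t),y)
   solves the equations with the same data (the pressure gradient absorbs b''), and a b' that
   oscillates wildly as t tends to S, with b' and b'' vanishing along a sequence of times,
   destroys smoothness at S although the maximum of the two norms does not tend to infinity and
   u_x stays bounded. *)
definition continuable_if_controlled ::
  "real \<Rightarrow> (real \<Rightarrow> real \<Rightarrow> real \<Rightarrow> real) \<Rightarrow> (real \<Rightarrow> real \<Rightarrow> real \<Rightarrow> real) \<Rightarrow> (real \<Rightarrow> real \<Rightarrow> real)
    \<Rightarrow> real \<Rightarrow> bool" where
  "continuable_if_controlled S u v p xh \<longleftrightarrow>
    (\<not> norms_blow_up S u p \<and> gradient_bounded_from S u v xh \<longrightarrow> extends_beyond S u v)"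

end

theory Submission
  imports Defs
begin

text \<open>
  The fluid column above \<open>xh\<close> never leaves a vertical line. Because the flux \<open>c t = \<integral> u dy\<close> does not
  depend on \<open>x\<close>, the line can be defined in advance by \<open>X' = c\<close>, \<open>X 0 = xh\<close>; an energy estimate for
  \<open>u - c\<close> on it gives \<open>u = c\<close> there, so \<open>X\<close> is the characteristic for every starting height and exists
  as long as the solution.  On the line, \<open>w = u_x\<close> satisfies
  \<open>w_t + v w_y + w\<^sup>2 = - p_xx = 2 \<integral> w\<^sup>2\<close>, hence \<open>w_yt + v w_yy = - w w_y\<close> and
  \<open>w_yyt + v w_yyy = - w_y\<^sup>2\<close>, so \<open>w\<close> stays decreasing and concave in \<open>y\<close> with mean zero.  For such
  profiles \<open>\<bar>w\<bar> \<le> m\<close> and \<open>\<integral> w\<^sup>2 \<le> m\<^sup>2 / 3\<close> with \<open>m = - w\<close> at \<open>y = 1\<close>, whence \<open>m' = m\<^sup>2 - 2 \<integral> w\<^sup>2 \<ge> m\<^sup>2 / 3\<close>.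
  The lifespan \<open>S\<close> is therefore finite, and since the increasing \<open>m\<close> controls the gradient on the
  column, it must tend to infinity at \<open>S\<close> if the norms do not.
\<close>

section \<open>Comparison lemmas on an interval and the energy method for transport
  inequalities\<close>

lemma mono_of_deriv_within:
  fixes f :: "real \<Rightarrow> real"
  assumes "a \<le> b"
    and der: "\<And>t. t \<in> {a..b} \<Longrightarrow> (f has_real_derivative f' t) (at t within {a..b})"
    and nonneg: "\<And>t. t \<in> {a..b} \<Longrightarrow> 0 \<le> f' t"
  shows "f a \<le> f b"
proof -
  have "\<exists>x\<in>{a..b}. f b - f a = f' x * (b - a)"
    using mvt_very_simple[OF \<open>a \<le> b\<close>, of f "\<lambda>x. (*) (f' x)"] der
    by (auto simp: has_field_derivative_def)
  with nonneg \<open>a \<le> b\<close> show ?thesis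
    by (metis diff_ge_0_iff_ge mult_nonneg_nonneg)
qed

text \<open>The differential inequality makes \<open>f t * exp (- K * t)\<close> nonincreasing, and
  it starts at zero.\<close>

lemma gronwall_zero:
  fixes f :: "real \<Rightarrow> real"
  assumes "0 \<le> T"
    and der: "\<And>t. t \<in> {0..T} \<Longrightarrow> (f has_real_derivative f' t) (at t within {0..T})"
    and bound: "\<And>t. t \<in> {0..T} \<Longrightarrow> f' t \<le> K * f t"
    and nonneg: "\<And>t. t \<in> {0..T} \<Longrightarrow> 0 \<le> f t"
    and init: "f 0 = 0"
    and t: "t \<in> {0..T}"
  shows "f t = 0"
proof -
  let ?h = "\<lambda>t. - (f t * exp (- K * t))"
  have "?h 0 \<le> ?h t"
  proof (rule mono_of_deriv_within[where f = ?h and f' = "\<lambda>t. (K * f t - f' t) * exp (- K * t)"])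
    fix s assume s: "s \<in> {0..t}"
    have "(f has_real_derivative f' s) (at s within {0..t})"
      using der[of s] s t by (auto intro: has_field_derivative_subset)
    then show "(?h has_real_derivative (K * f s - f' s) * exp (- K * s)) (at s within {0..t})"
      by (auto intro!: derivative_eq_intros simp: algebra_simps)
    show "0 \<le> (K * f s - f' s) * exp (- K * s)"
      using bound[of s] s t by auto
  qed (use t in auto)
  then have "f t * exp (- K * t) \<le> 0" using init by simp
  then have "f t \<le> 0" by (simp add: mult_le_0_iff)
  with nonneg[OF t] show ?thesis by simp
qed

text \<open>Squaring removes the kink of the positive part at zero, so a sign condition can be
  propagated by a differentiable energy.\<close>

lemma pos_part_sq_deriv:
  "((\<lambda>x::real. (max x 0)\<^sup>2) has_real_derivative 2 * max x 0) (at x)"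
proof (cases x "0::real" rule: linorder_cases)
  case less
  have "((\<lambda>x::real. 0) has_real_derivative 0) (at x)" by simp
  then have "((\<lambda>x::real. (max x 0)\<^sup>2) has_real_derivative 0) (at x)"
    by (rule has_field_derivative_transform_within_open[where S = "{..<0}"]) (use less in auto)
  with less show ?thesis by simp
next
  case greater
  have "((\<lambda>x::real. x\<^sup>2) has_real_derivative 2 * x) (at x)"
    by (auto intro!: derivative_eq_intros)
  then have "((\<lambda>x::real. (max x 0)\<^sup>2) has_real_derivative 2 * x) (at x)"
    by (rule has_field_derivative_transform_within_open[where S = "{0<..}"]) (use greater in auto)
  with greater show ?thesis by simp
next
  case equal
  have "((\<lambda>h. max h 0 * sgn h) \<longlongrightarrow> 0) (at (0::real))"
    by (rule tendsto_sandwich[where f = "\<lambda>h. - \<bar>h\<bar>" and h = "\<lambda>h. \<bar>h\<bar>"])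
      (auto intro!: always_eventually tendsto_eq_intros simp: max_def sgn_if)
  moreover have "(max h 0)\<^sup>2 / h = max h 0 * sgn h" for h :: real
    by (auto simp: max_def sgn_if power2_eq_square)
  ultimately show ?thesis
    using equal by (simp add: has_field_derivative_iff)
qed

text \<open>The integral of \<open>f\<close> over the unit interval satisfies a Gronwall inequality:
  the transport term is integrated by parts without boundary terms, which leaves
  \<open>vy * f\<close>, bounded by a multiple of \<open>f\<close>. The source \<open>g\<close>
  makes room for a term that vanishes only on average, such as a pressure gradient.\<close>

lemma energy_vanishes:
  fixes f ft fy v vy g :: "real \<Rightarrow> real \<Rightarrow> real"
  assumes "0 \<le> T"
    and contf: "continuous_on ({0..T} \<times> {0..1}) (\<lambda>(t, y). f t y)"
    and contft: "continuous_on ({0..T} \<times> {0..1}) (\<lambda>(t, y). ft t y)"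
    and contfy: "continuous_on ({0..T} \<times> {0..1}) (\<lambda>(t, y). fy t y)"
    and contv: "continuous_on ({0..T} \<times> {0..1}) (\<lambda>(t, y). v t y)"
    and contvy: "continuous_on ({0..T} \<times> {0..1}) (\<lambda>(t, y). vy t y)"
    and dt: "\<And>t y. t \<in> {0..T} \<Longrightarrow> y \<in> {0..1} \<Longrightarrow>
        ((\<lambda>s. f s y) has_real_derivative ft t y) (at t within {0..T})"
    and dy: "\<And>t y. t \<in> {0..T} \<Longrightarrow> y \<in> {0..1} \<Longrightarrow>
        (f t has_real_derivative fy t y) (at y within {0..1})"
    and dv: "\<And>t y. t \<in> {0..T} \<Longrightarrow> y \<in> {0..1} \<Longrightarrow>
        (v t has_real_derivative vy t y) (at y within {0..1})"
    and bdry: "\<And>t. t \<in> {0..T} \<Longrightarrow> v t 0 = 0 \<and> v t 1 = 0"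
    and nonneg: "\<And>t y. t \<in> {0..T} \<Longrightarrow> y \<in> {0..1} \<Longrightarrow> 0 \<le> f t y"
    and init: "\<And>y. y \<in> {0..1} \<Longrightarrow> f 0 y = 0"
    and ineq: "\<And>t y. t \<in> {0..T} \<Longrightarrow> y \<in> {0..1} \<Longrightarrow>
        ft t y + v t y * fy t y \<le> L * f t y + g t y"
    and g: "\<And>t. t \<in> {0..T} \<Longrightarrow> (g t has_integral 0) {0..1}"
    and t: "t \<in> {0..T}" and y: "y \<in> {0..1}"
  shows "f t y = 0"
proof -
  have slice: "continuous_on {0..1} (h s)"
    if "continuous_on ({0..T} \<times> {0..1}) (\<lambda>(t, y). h t y)" "s \<in> {0..T}"
    for h :: "real \<Rightarrow> real \<Rightarrow> real" and s
    using continuous_on_compose2[OF that(1),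
        OF continuous_on_Pair[OF continuous_on_const[of "{0..1}" s] continuous_on_id]] that(2)
    by (simp add: image_subset_iff)
  obtain B where B: "\<And>t y. t \<in> {0..T} \<Longrightarrow> y \<in> {0..1} \<Longrightarrow> \<bar>vy t y\<bar> \<le> B"
  proof -
    have "compact ((\<lambda>(t, y). vy t y) ` ({0..T} \<times> {0..1}))"
      by (intro compact_continuous_image contvy compact_Times) auto
    then obtain B where "\<forall>x\<in>(\<lambda>(t, y). vy t y) ` ({0..T} \<times> {0..1}). norm x \<le> B"
      using compact_imp_bounded bounded_iff by metis
    then show thesis by (intro that[of B]) force
  qed
  define E where "E s = integral {0..1} (f s)" for s
  have dE: "(E has_real_derivative integral {0..1} (ft s)) (at s within {0..T})"
    if s: "s \<in> {0..T}" for s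
    using leibniz_rule_field_derivative[of "{0..T}" 0 1 f ft s] dt contft s
      integrable_continuous_real[OF slice[OF contf]]
    unfolding E_def by simp
  have E': "integral {0..1} (ft s) \<le> (L + B) * E s" if s: "s \<in> {0..T}" for s
  proof -
    \<comment> \<open>The integrand is the \<open>y\<close>-derivative of \<open>v * f\<close>, and
      \<open>v\<close> vanishes at both ends.\<close>
    have i1: "((\<lambda>y. vy s y * f s y + v s y * fy s y) has_integral 0) {0..1}"
    proof -
      have "((\<lambda>y. vy s y * f s y + v s y * fy s y) has_integral v s 1 * f s 1 - v s 0 * f s 0) {0..1}"
        by (rule fundamental_theorem_of_calculus)
          (auto intro!: derivative_eq_intros dy dv s
            simp: has_real_derivative_iff_has_vector_derivative[symmetric])
      with bdry[OF s] show ?thesis by simp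
    qed
    have i2: "((\<lambda>y. (L + B) * f s y) has_integral (L + B) * E s) {0..1}"
      unfolding E_def
      by (intro has_integral_mult_right integrable_integral integrable_continuous_real slice contf s)
    have i3: "(ft s has_integral integral {0..1} (ft s)) {0..1}"
      by (intro integrable_integral integrable_continuous_real slice contft s)
    have "((\<lambda>y. (L + B) * f s y - (vy s y * f s y + v s y * fy s y) + g s y)
        has_integral (L + B) * E s - 0 + 0) {0..1}"
      by (intro has_integral_add has_integral_diff i1 i2 g s)
    moreover have "ft s y \<le> (L + B) * f s y - (vy s y * f s y + v s y * fy s y) + g s y"
      if y: "y \<in> {0..1}" for y
    proof -
      have "vy s y * f s y \<le> B * f s y"
        using B[OF s y] nonneg[OF s y] by (intro mult_right_mono) auto
      then show ?thesis using ineq[OF s y] by (simp add: algebra_simps)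
    qed
    ultimately show ?thesis
      using has_integral_le[OF i3] by fastforce
  qed
  have "E t = 0"
  proof (rule gronwall_zero[OF \<open>0 \<le> T\<close> dE E' _ _ t])
    show "0 \<le> E s" if "s \<in> {0..T}" for s
      unfolding E_def using nonneg that
      by (intro integral_nonneg integrable_continuous_real slice contf) auto
    have "(f 0 has_integral 0) {0..1}"
      by (rule has_integral_is_0) (rule init)
    then show "E 0 = 0" by (simp add: E_def integral_unique)
  qed auto
  then show ?thesis
    using integral_eq_0_iff[OF slice[OF contf t]] nonneg t y unfolding E_def by auto
qed

text \<open>The inequality for \<open>q\<close>, multiplied by \<open>2 * max q 0\<close>, becomes
  an energy inequality for the squared positive part, which is zero at the start. An upper bound on
  \<open>r\<close> suffices because \<open>r\<close> then multiplies a nonnegative quantity.\<close>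

lemma transport_nonpos:
  fixes q qt qy v vy r :: "real \<Rightarrow> real \<Rightarrow> real"
  assumes "0 \<le> T"
    and contq: "continuous_on ({0..T} \<times> {0..1}) (\<lambda>(t, y). q t y)"
    and contqt: "continuous_on ({0..T} \<times> {0..1}) (\<lambda>(t, y). qt t y)"
    and contqy: "continuous_on ({0..T} \<times> {0..1}) (\<lambda>(t, y). qy t y)"
    and contv: "continuous_on ({0..T} \<times> {0..1}) (\<lambda>(t, y). v t y)"
    and contvy: "continuous_on ({0..T} \<times> {0..1}) (\<lambda>(t, y). vy t y)"
    and dt: "\<And>t y. t \<in> {0..T} \<Longrightarrow> y \<in> {0..1} \<Longrightarrow>
        ((\<lambda>s. q s y) has_real_derivative qt t y) (at t within {0..T})"
    and dy: "\<And>t y. t \<in> {0..T} \<Longrightarrow> y \<in> {0..1} \<Longrightarrow>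
        (q t has_real_derivative qy t y) (at y within {0..1})"
    and dv: "\<And>t y. t \<in> {0..T} \<Longrightarrow> y \<in> {0..1} \<Longrightarrow>
        (v t has_real_derivative vy t y) (at y within {0..1})"
    and bdry: "\<And>t. t \<in> {0..T} \<Longrightarrow> v t 0 = 0 \<and> v t 1 = 0"
    and init: "\<And>y. y \<in> {0..1} \<Longrightarrow> q 0 y \<le> 0"
    and r: "\<And>t y. t \<in> {0..T} \<Longrightarrow> y \<in> {0..1} \<Longrightarrow> r t y \<le> K"
    and ineq: "\<And>t y. t \<in> {0..T} \<Longrightarrow> y \<in> {0..1} \<Longrightarrow>
        qt t y + v t y * qy t y \<le> r t y * q t y"
    and t: "t \<in> {0..T}" and y: "y \<in> {0..1}"
  shows "q t y \<le> 0"
proof -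
  define f where "f s y = (max (q s y) 0)\<^sup>2" for s y
  have "f t y = 0"
  proof (rule energy_vanishes[where T = T and f = f and v = v and vy = vy
        and ft = "\<lambda>s y. 2 * max (q s y) 0 * qt s y" and fy = "\<lambda>s y. 2 * max (q s y) 0 * qy s y"
        and L = "2 * K" and g = "\<lambda>_ _. 0"])
    show "continuous_on ({0..T} \<times> {0..1}) (\<lambda>(t, y). f t y)"
      unfolding f_def using contq by (auto intro!: continuous_intros simp: split_beta)
    show "continuous_on ({0..T} \<times> {0..1}) (\<lambda>(s, y). 2 * max (q s y) 0 * qt s y)"
      using contq contqt by (auto intro!: continuous_intros simp: split_beta)
    show "continuous_on ({0..T} \<times> {0..1}) (\<lambda>(s, y). 2 * max (q s y) 0 * qy s y)"
      using contq contqy by (auto intro!: continuous_intros simp: split_beta)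
  next
    fix s y assume sy: "s \<in> {0..T}" "y \<in> {0..(1::real)}"
    show "((\<lambda>s. f s y) has_real_derivative 2 * max (q s y) 0 * qt s y) (at s within {0..T})"
      unfolding f_def by (rule DERIV_chain2[OF pos_part_sq_deriv dt[OF sy]])
    show "(f s has_real_derivative 2 * max (q s y) 0 * qy s y) (at y within {0..1})"
      unfolding f_def by (rule DERIV_chain2[OF pos_part_sq_deriv dy[OF sy]])
    have "2 * max (q s y) 0 * (qt s y + v s y * qy s y) \<le> 2 * max (q s y) 0 * (r s y * q s y)"
      by (intro mult_left_mono ineq sy) auto
    also have "\<dots> = 2 * (r s y * f s y)"
      by (auto simp: f_def max_def power2_eq_square)
    also have "\<dots> \<le> 2 * (K * f s y)"
      using r[OF sy] by (auto simp: f_def intro!: mult_right_mono)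
    finally show "2 * max (q s y) 0 * qt s y + v s y * (2 * max (q s y) 0 * qy s y)
        \<le> 2 * K * f s y + 0"
      by (simp add: algebra_simps)
  qed (use assms in \<open>auto simp: f_def max_def\<close>)
  then show ?thesis by (auto simp: f_def max_def split: if_splits)
qed

section \<open>Mean-zero concave profiles\<close>

text \<open>With \<open>g y = m * (1 - 2 * y) - w y\<close>, which is convex with mean zero and \<open>g 1 = 0\<close>, the
  primitive of \<open>g\<close> is nonnegative; integrating it against \<open>- (w' - 2 * m)\<close> compares the
  squares of \<open>w\<close> and of \<open>m * (1 - 2 * y)\<close>.\<close>

lemma concave_mean_zero_bounds:
  fixes w w' :: "real \<Rightarrow> real"
  assumes dw: "\<And>y. y \<in> {0..1} \<Longrightarrow> (w has_real_derivative w' y) (at y within {0..1})"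
    and cont: "continuous_on {0..1} w'"
    and nonpos: "\<And>y. y \<in> {0..1} \<Longrightarrow> w' y \<le> 0"
    and anti: "\<And>x y. 0 \<le> x \<Longrightarrow> x \<le> y \<Longrightarrow> y \<le> 1 \<Longrightarrow> w' y \<le> w' x"
    and mean: "(w has_integral 0) {0..1}"
  shows "integral {0..1} (\<lambda>y. (w y)\<^sup>2) \<le> (w 1)\<^sup>2 / 3"
    and "\<And>y. y \<in> {0..1} \<Longrightarrow> \<bar>w y\<bar> \<le> - w 1"
proof -
  define m where "m = - w 1"
  define g where "g y = m * (1 - 2 * y) - w y" for y
  define G where "G y = integral {0..y} g" for y
  have contw: "continuous_on {0..1} w"
    using dw by (rule DERIV_continuous_on)
  have contg: "continuous_on {0..1} g"
    unfolding g_def by (intro continuous_intros contw)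
  have dg: "(g has_real_derivative - 2 * m - w' y) (at y within {0..1})" if "y \<in> {0..1}" for y
    unfolding g_def by (auto intro!: derivative_eq_intros dw that)
  have mvt: "\<exists>\<xi>\<in>{a..b}. g b - g a = (- 2 * m - w' \<xi>) * (b - a)" if "0 \<le> a" "a \<le> b" "b \<le> 1" for a b
  proof -
    have "(g has_derivative (*) (- 2 * m - w' y)) (at y within {a..b})" if "a \<le> y" "y \<le> b" for y
      using has_field_derivative_subset[OF dg, of y "{a..b}"] that \<open>0 \<le> a\<close> \<open>b \<le> 1\<close>
      by (auto simp: has_field_derivative_def)
    from mvt_very_simple[OF \<open>a \<le> b\<close> this] show ?thesis by auto
  qed
  have g1: "g 1 = 0" by (simp add: g_def m_def)
  \<comment> \<open>Convexity in terms of slopes: \<open>g\<close> falls from \<open>g s > 0\<close>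
    to \<open>g 1 = 0\<close>, so its slope at some \<open>b\<close> after \<open>s\<close> is
    nonpositive, and so is the slope at the earlier point \<open>a\<close>. Hence \<open>g y\<close>
    is at least \<open>g s\<close>.\<close>
  have sgn_g: "0 \<le> g y" if ys: "0 \<le> y" "y \<le> s" "s \<le> 1" "0 < g s" for y s
  proof -
    obtain a where a: "a \<in> {y..s}" "g s - g y = (- 2 * m - w' a) * (s - y)"
      using mvt[of y s] \<open>0 \<le> y\<close> \<open>y \<le> s\<close> \<open>s \<le> 1\<close> by auto
    obtain b where b: "b \<in> {s..1}" "g 1 - g s = (- 2 * m - w' b) * (1 - s)"
      using mvt[of s 1] order_trans[OF ys(1,2)] ys(3) by auto
    have "(- 2 * m - w' b) * (1 - s) < 0" using b g1 that by simp
    then have "- 2 * m - w' b \<le> 0"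
      using \<open>s \<le> 1\<close> by (simp add: mult_less_0_iff)
    moreover have "w' b \<le> w' a" using anti[of a b] a b that by auto
    ultimately have "(- 2 * m - w' a) * (s - y) \<le> 0"
      using \<open>y \<le> s\<close> by (intro mult_nonpos_nonneg) auto
    with a that show ?thesis by simp
  qed
  have int_g: "(g has_integral 0) {0..1}"
  proof -
    have "((\<lambda>y. m * (1 - 2 * y)) has_integral (m * (1 - 1\<^sup>2) - m * (0 - 0\<^sup>2))) {0..1}"
      by (rule fundamental_theorem_of_calculus)
        (auto intro!: derivative_eq_intros
          simp: has_real_derivative_iff_has_vector_derivative[symmetric])
    then have "((\<lambda>y. m * (1 - 2 * y)) has_integral 0) {0..1}" by simp
    from has_integral_diff[OF this mean] show ?thesis by (simp add: g_def[abs_def])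
  qed
  have int_sub: "g integrable_on {a..b}" if "0 \<le> a" "b \<le> 1" for a b
    by (intro integrable_continuous_real continuous_on_subset[OF contg]) (use that in auto)
  \<comment> \<open>The set where \<open>g\<close> is positive is an initial segment. Inside it
    \<open>G y\<close> integrates nonnegative values; beyond it \<open>G y\<close> is minus the
    integral of \<open>g\<close> over \<open>{y..1}\<close>, because \<open>g\<close> has mean
    zero.\<close>
  have G_nonneg: "0 \<le> G y" if y: "y \<in> {0..1}" for y
  proof (cases "0 < g y")
    case True
    then show ?thesis
      unfolding G_def using y sgn_g[of _ y] by (intro integral_nonneg int_sub) auto
  next
    case False
    \<comment> \<open>A rise from \<open>g y \<le> 0\<close> to \<open>g s > 0\<close> would by
      convexity continue up to 1, against \<open>g 1 = 0\<close>.\<close>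
    have "g s \<le> 0" if s: "s \<in> {y..1}" for s
    proof (rule ccontr)
      assume "\<not> g s \<le> 0"
      then have pos: "0 < g s" by simp
      obtain a where a: "a \<in> {y..s}" "g s - g y = (- 2 * m - w' a) * (s - y)"
        using mvt[of y s] y s by auto
      obtain b where b: "b \<in> {s..1}" "g 1 - g s = (- 2 * m - w' b) * (1 - s)"
        using mvt[of s 1] order_trans[of 0 y s] y s by auto
      have "0 < (- 2 * m - w' a) * (s - y)" using a pos False by simp
      then have "0 \<le> - 2 * m - w' a" using that by (simp add: zero_less_mult_iff)
      moreover have "w' b \<le> w' a" using anti[of a b] a b y that by auto
      ultimately have "0 \<le> (- 2 * m - w' b) * (1 - s)"
        using that by (intro mult_nonneg_nonneg) auto
      with b pos g1 show False by simp
    qed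
    then have "integral {y..1} g \<le> 0"
      using integral_le[OF int_sub[of y 1], of "\<lambda>_. 0"] y by auto
    moreover have "G y + integral {y..1} g = integral {0..1} g"
      unfolding G_def using y by (intro Henstock_Kurzweil_Integration.integral_combine int_sub) auto
    ultimately show ?thesis using int_g by (simp add: integral_unique)
  qed
  have dG: "(G has_real_derivative g y) (at y within {0..1})" if "y \<in> {0..1}" for y
    unfolding G_def by (rule integral_has_real_derivative[OF contg that])
  have G01: "G 0 = 0" "G 1 = 0"
    using int_g by (auto simp: G_def integral_unique)
  have contG: "continuous_on {0..1} G"
    using dG by (rule DERIV_continuous_on)
  have w_mono: "w y \<le> w x" if "0 \<le> x" "x \<le> y" "y \<le> 1" for x y
  proof -
    have "(w has_real_derivative w' s) (at s within {x..y})" if "s \<in> {x..y}" for s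
      using has_field_derivative_subset[OF dw, of s "{x..y}"] that \<open>0 \<le> x\<close> \<open>y \<le> 1\<close> by auto
    then have "- w x \<le> - w y"
      using that nonpos
      by (intro mono_of_deriv_within[where f = "\<lambda>s. - w s" and f' = "\<lambda>s. - w' s"]) (auto intro!: derivative_intros)
    then show ?thesis by simp
  qed
  have "0 \<le> m"
  proof (rule ccontr)
    assume "\<not> 0 \<le> m"
    then have "0 < w 1" by (simp add: m_def)
    then have "((\<lambda>_. w 1) has_integral w 1 * 1) {0..(1::real)}"
      using has_integral_const_real[of "w 1" 0 1] by simp
    from has_integral_le[OF this mean] w_mono[of _ 1] \<open>0 < w 1\<close> show False by force
  qed
  \<comment> \<open>If \<open>g 0\<close> were negative, \<open>g\<close> would be nonpositive
    everywhere by \<open>sgn_g\<close>, hence zero by its mean. The inequality bounds the largest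
    value \<open>w 0\<close> by \<open>m\<close>.\<close>
  have "0 \<le> g 0"
  proof (rule ccontr)
    assume neg: "\<not> 0 \<le> g 0"
    have "g s \<le> 0" if "s \<in> {0..1}" for s
      using sgn_g[of 0 s] neg that by fastforce
    then have "integral {0..1} (\<lambda>y. - g y) = 0 \<longleftrightarrow> (\<forall>y\<in>{0..1}. - g y = 0)"
      by (intro integral_eq_0_iff continuous_intros contg) auto
    with int_g neg show False by (auto simp: integral_unique)
  qed
  then have "w 0 \<le> m" by (simp add: g_def)
  then show "\<bar>w y\<bar> \<le> - w 1" if "y \<in> {0..1}" for y
    using w_mono[of 0 y] w_mono[of y 1] that by (auto simp: m_def abs_le_iff)
  \<comment> \<open>This is the derivative of \<open>G y * (m * (1 - 2 * y) + w y)\<close>, and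
    \<open>G\<close> vanishes at both ends.\<close>
  let ?d = "\<lambda>y. g y * (m * (1 - 2 * y) + w y) + G y * (- 2 * m + w' y)"
  have i1: "(?d has_integral 0) {0..1}"
  proof -
    have "(?d has_integral G 1 * (m * (1 - 2 * 1) + w 1) - G 0 * (m * (1 - 2 * 0) + w 0)) {0..1}"
      by (rule fundamental_theorem_of_calculus)
        (auto intro!: derivative_eq_intros dG dw
          simp: has_real_derivative_iff_has_vector_derivative[symmetric])
    then show ?thesis by (simp add: G01)
  qed
  have i2: "((\<lambda>y. (m * (1 - 2 * y))\<^sup>2) has_integral m\<^sup>2 / 3) {0..1}"
  proof -
    have "((\<lambda>y. (m * (1 - 2 * y))\<^sup>2) has_integral
        (m\<^sup>2 * (1 - 2 * 1\<^sup>2 + 4 / 3 * 1 ^ 3) - m\<^sup>2 * (0 - 2 * 0\<^sup>2 + 4 / 3 * 0 ^ 3))) {0..1}"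
      by (rule fundamental_theorem_of_calculus)
        (auto intro!: derivative_eq_intros
          simp: has_real_derivative_iff_has_vector_derivative[symmetric]
            algebra_simps power2_eq_square)
    then show ?thesis by simp
  qed
  have i3: "((\<lambda>y. (w y)\<^sup>2) has_integral integral {0..1} (\<lambda>y. (w y)\<^sup>2)) {0..1}"
    by (intro integrable_integral integrable_continuous_real continuous_intros contw)
  have "((\<lambda>y. (m * (1 - 2 * y))\<^sup>2 - ?d y) has_integral m\<^sup>2 / 3 - 0) {0..1}"
    by (intro has_integral_diff i1 i2)
  from i3 this have "integral {0..1} (\<lambda>y. (w y)\<^sup>2) \<le> m\<^sup>2 / 3 - 0"
  proof (rule has_integral_le)
    fix y :: real assume y: "y \<in> {0..1}"
    have "G y * (- 2 * m + w' y) \<le> 0"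
      using G_nonneg[OF y] \<open>0 \<le> m\<close> nonpos[OF y] by (intro mult_nonneg_nonpos) auto
    moreover have "g y * (m * (1 - 2 * y) + w y) = (m * (1 - 2 * y))\<^sup>2 - (w y)\<^sup>2"
      by (simp add: g_def power2_eq_square algebra_simps)
    ultimately show "(w y)\<^sup>2 \<le> (m * (1 - 2 * y))\<^sup>2 - ?d y" by simp
  qed
  then show "integral {0..1} (\<lambda>y. (w y)\<^sup>2) \<le> (w 1)\<^sup>2 / 3"
    by (simp add: m_def)
qed

section \<open>One-sided derivatives and the time domain\<close>

text \<open>Permits differentiating an identity known only on a closed interval, endpoints
  included.\<close>

lemma deriv_eq_of_eq_on_Icc:
  fixes f g :: "real \<Rightarrow> real"
  assumes "a < b" and y: "y \<in> {a..b}"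
    and f: "(f has_real_derivative f') (at y within {a..b})"
    and g: "(g has_real_derivative g') (at y within {a..b})"
    and eq: "\<And>s. s \<in> {a..b} \<Longrightarrow> f s = g s"
  shows "f' = g'"
proof -
  have "(f has_real_derivative g') (at y within {a..b})"
    using g by (rule has_field_derivative_transform_within[OF _ zero_less_one y]) (simp add: eq)
  then show ?thesis
    using f vector_derivative_unique_within_closed_interval[of a b y f f' g'] y \<open>a < b\<close>
    by (simp add: has_real_derivative_iff_has_vector_derivative)
qed

text \<open>Near \<open>t < T\<close> the two sets coincide. Arguments on compact time intervals
  thus yield the derivatives within \<open>{0..}\<close> in which the equations are stated;
  \<open>time_dom_later\<close> supplies the \<open>T\<close>.\<close>

lemma deriv_within_Icc_imp_Ici:
  fixes f :: "real \<Rightarrow> real"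
  assumes "(f has_real_derivative f') (at t within {0..T})" "t < T"
  shows "(f has_real_derivative f') (at t within {0..})"
proof -
  have "at t within {0..T} = at t within {0..}"
    using \<open>t < T\<close> by (intro at_within_nhd[of t "{..<T}"]) auto
  with assms show ?thesis by simp
qed

lemma time_dom_0: "0 < Tm \<Longrightarrow> 0 \<in> time_dom Tm"
  by (simp add: time_dom_def zero_ereal_def)

lemma time_dom_Icc: "t \<in> time_dom Tm \<Longrightarrow> {0..t} \<subseteq> time_dom Tm"
  by (auto simp: time_dom_def intro: le_less_trans[of "ereal _" "ereal t" Tm])

lemma time_dom_later:
  assumes "t \<in> time_dom Tm"
  obtains T where "t < T" "T \<in> time_dom Tm"
proof -
  have "ereal t < Tm" using assms by (simp add: time_dom_def)
  then obtain T where "ereal t < ereal T" "ereal T < Tm"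
    using ereal_dense2 by blast
  with assms show thesis by (intro that[of T]) (auto simp: time_dom_def)
qed

text \<open>Fixing the family \<open>D\<close> as a parameter names every mixed partial by its
  orders, so the interchange of partial derivatives is built into the indexing.\<close>

locale smooth_partials =
  fixes Tm :: ereal
    and D :: "nat \<Rightarrow> nat \<Rightarrow> nat \<Rightarrow> real \<Rightarrow> real \<Rightarrow> real \<Rightarrow> real"
  assumes cont: "continuous_on (time_dom Tm \<times> UNIV \<times> {0..1}) (\<lambda>(t, x, y). D i j k t x y)"
    and deriv_t: "t \<in> time_dom Tm \<Longrightarrow> y \<in> {0..1} \<Longrightarrow>
      ((\<lambda>s. D i j k s x y) has_real_derivative D (Suc i) j k t x y) (at t within {0..})"
    and deriv_x: "t \<in> time_dom Tm \<Longrightarrow> y \<in> {0..1} \<Longrightarrow>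
      ((\<lambda>s. D i j k t s y) has_real_derivative D i (Suc j) k t x y) (at x)"
    and deriv_y: "t \<in> time_dom Tm \<Longrightarrow> y \<in> {0..1} \<Longrightarrow>
      (D i j k t x has_real_derivative D i j (Suc k) t x y) (at y within {0..1})"
begin

lemma continuous_comp:
  assumes "continuous_on A a" "continuous_on A b" "continuous_on A c"
    and "\<And>z. z \<in> A \<Longrightarrow> a z \<in> time_dom Tm" "\<And>z. z \<in> A \<Longrightarrow> c z \<in> {0..1}"
  shows "continuous_on A (\<lambda>z. D i j k (a z) (b z) (c z))"
proof -
  have "continuous_on A (\<lambda>z. (\<lambda>(t, x, y). D i j k t x y) (a z, b z, c z))"
    by (rule continuous_on_compose2[OF cont])
      (use assms in \<open>auto intro!: continuous_on_Pair\<close>)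
  then show ?thesis by simp
qed

lemma continuous_y: "t \<in> time_dom Tm \<Longrightarrow> continuous_on {0..1} (D i j k t x)"
  by (rule continuous_comp) (auto intro!: continuous_intros)

lemma bounded_on_compact:
  assumes "T \<in> time_dom Tm"
  obtains K where "\<And>t x y. t \<in> {0..T} \<Longrightarrow> x \<in> {-R..R} \<Longrightarrow> y \<in> {0..1} \<Longrightarrow> \<bar>D i j k t x y\<bar> \<le> K"
proof -
  have "compact ((\<lambda>(t, x, y). D i j k t x y) ` ({0..T} \<times> {-R..R} \<times> {0..1}))"
    using time_dom_Icc[OF assms]
    by (intro compact_continuous_image continuous_on_subset[OF cont] compact_Times) auto
  then obtain K where "\<forall>x\<in>(\<lambda>(t, x, y). D i j k t x y) ` ({0..T} \<times> {-R..R} \<times> {0..1}). norm x \<le> K"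
    using compact_imp_bounded bounded_iff by metis
  then show thesis by (intro that[of K]) force
qed

text \<open>The chain rule along a line moving with velocity \<open>c\<close>, at fixed
  height.\<close>

lemma deriv_along:
  assumes t: "t \<in> time_dom Tm" and y: "y \<in> {0..1}"
    and X: "(X has_real_derivative c) (at t within {0..})"
  shows "((\<lambda>s. D i j k s (X s) y) has_real_derivative
      D (Suc i) j k t (X t) y + c * D i (Suc j) k t (X t) y) (at t within {0..})"
proof -
  obtain T where T: "t < T" "T \<in> time_dom Tm" using t by (rule time_dom_later)
  have sub: "{0..T} \<subseteq> time_dom Tm" using T by (intro time_dom_Icc)
  have t0: "0 \<le> t" using t by (simp add: time_dom_def)
  \<comment> \<open>A total derivative is obtained from the partials: the one in \<open>t\<close> at
    the point itself, and the one in \<open>x\<close> nearby together with its continuity.\<close>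
  have "((\<lambda>(s, x). D i j k s x y) has_derivative
      (\<lambda>(ds, dx). D (Suc i) j k t (X t) y * ds + blinfun_mult_right (D i (Suc j) k t (X t) y) dx))
      (at (t, X t) within {0..T} \<times> UNIV)"
  proof (rule has_derivative_partialsI[where fy = "\<lambda>s x. blinfun_mult_right (D i (Suc j) k s x y)"])
    show "((\<lambda>s. D i j k s (X t) y) has_derivative (*) (D (Suc i) j k t (X t) y)) (at t within {0..T})"
      using has_field_derivative_subset[OF deriv_t[OF t y], of "{0..T}"]
      by (auto simp: has_field_derivative_def)
    show "((\<lambda>x. D i j k s x y) has_derivative blinfun_mult_right (D i (Suc j) k s x y)) (at x)"
      if "s \<in> {0..T}" for s x
      using deriv_x[of s y i j k x] that sub y by (auto simp: has_field_derivative_def)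
    have "continuous_on ({0..T} \<times> UNIV) (\<lambda>z. D i (Suc j) k (fst z) (snd z) y)"
      using sub y by (intro continuous_comp) (auto intro!: continuous_intros)
    then have "continuous_on ({0..T} \<times> UNIV) (\<lambda>z. blinfun_mult_right (D i (Suc j) k (fst z) (snd z) y))"
      by (intro bounded_linear.continuous_on[OF bounded_linear_blinfun_mult_right])
    then show "continuous (at (t, X t) within {0..T} \<times> UNIV)
        (\<lambda>(s, x). blinfun_mult_right (D i (Suc j) k s x y))"
      using T t0 by (simp add: continuous_on_eq_continuous_within case_prod_unfold)
  qed auto
  then have 1: "((\<lambda>(s, x). D i j k s x y) has_derivative
      (\<lambda>(ds, dx). D (Suc i) j k t (X t) y * ds + D i (Suc j) k t (X t) y * dx))
      (at (t, X t) within (\<lambda>s. (s, X s)) ` {0..T})"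
    by (auto intro: has_derivative_subset)
  have "((\<lambda>s. (s, X s)) has_derivative (\<lambda>h. (h, c * h))) (at t within {0..T})"
    using has_field_derivative_subset[OF X, of "{0..T}"]
    by (auto intro!: has_derivative_Pair simp: has_field_derivative_def)
  from has_derivative_in_compose[OF this 1]
  have "((\<lambda>s. D i j k s (X s) y) has_derivative
      (\<lambda>h. D (Suc i) j k t (X t) y * h + D i (Suc j) k t (X t) y * (c * h))) (at t within {0..T})"
    by simp
  moreover have "(\<lambda>h. D (Suc i) j k t (X t) y * h + D i (Suc j) k t (X t) y * (c * h)) =
      (*) (D (Suc i) j k t (X t) y + c * D i (Suc j) k t (X t) y)"
    by (simp add: fun_eq_iff algebra_simps)
  ultimately have "((\<lambda>s. D i j k s (X s) y) has_real_derivative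
      D (Suc i) j k t (X t) y + c * D i (Suc j) k t (X t) y) (at t within {0..T})"
    by (simp add: has_field_derivative_def)
  then show ?thesis using T by (intro deriv_within_Icc_imp_Ici)
qed

end

section \<open>The flux and the moving column\<close>

text \<open>Pressure derivatives are read off at height 0, which makes their independence of
  \<open>y\<close> visible in \<open>momentum\<close>.\<close>

locale hydrostatic_column =
  U: smooth_partials Tm U + V: smooth_partials Tm V + P: smooth_partials Tm P
  for Tm :: ereal and U V P :: "nat \<Rightarrow> nat \<Rightarrow> nat \<Rightarrow> real \<Rightarrow> real \<Rightarrow> real \<Rightarrow> real" +
  fixes xh uh :: real
  assumes Tm_pos: "0 < Tm"
    and momentum: "t \<in> time_dom Tm \<Longrightarrow> y \<in> {0..1} \<Longrightarrow>
      U (Suc 0) 0 0 t x y + U 0 0 0 t x y * U 0 (Suc 0) 0 t x y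
        + V 0 0 0 t x y * U 0 0 (Suc 0) t x y = - P 0 (Suc 0) 0 t x 0"
    and incompressible: "t \<in> time_dom Tm \<Longrightarrow> y \<in> {0..1} \<Longrightarrow>
      U 0 (Suc 0) 0 t x y + V 0 0 (Suc 0) t x y = 0"
    and v_bottom: "t \<in> time_dom Tm \<Longrightarrow> V 0 0 0 t x 0 = 0"
    and v_top: "t \<in> time_dom Tm \<Longrightarrow> V 0 0 0 t x 1 = 0"
    and init_u: "y \<in> {0..1} \<Longrightarrow> U 0 0 0 0 xh y = uh"
    and init_uxy: "U 0 (Suc 0) (Suc 0) 0 xh 0 = 0"
    and init_uxyy: "y \<in> {0<..<1} \<Longrightarrow> U 0 (Suc 0) (Suc (Suc 0)) 0 xh y < 0"
begin

abbreviation "u \<equiv> U 0 0 0"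
abbreviation "ux \<equiv> U 0 (Suc 0) 0"
abbreviation "uy \<equiv> U 0 0 (Suc 0)"
abbreviation "uxy \<equiv> U 0 (Suc 0) (Suc 0)"
abbreviation "uxyy \<equiv> U 0 (Suc 0) (Suc (Suc 0))"
abbreviation "v \<equiv> V 0 0 0"

text \<open>The abscissa 0 is an arbitrary choice: by \<open>u_mean\<close> every \<open>x\<close>
  gives the same flux.\<close>

definition c :: "real \<Rightarrow> real" where
  "c t = integral {0..1} (u t 0)"

definition X :: "real \<Rightarrow> real" where
  "X t = xh + integral {0..t} c"

lemma X_0: "X 0 = xh"
  by (simp add: X_def)

lemma vy_eq: "t \<in> time_dom Tm \<Longrightarrow> y \<in> {0..1} \<Longrightarrow> V 0 0 (Suc 0) t x y = - ux t x y"
  using incompressible[of t y x] by simp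

lemma deriv_v:
  "t \<in> time_dom Tm \<Longrightarrow> y \<in> {0..1} \<Longrightarrow> (v t x has_real_derivative - ux t x y) (at y within {0..1})"
  using V.deriv_y[of t y 0 0 0 x] by (simp add: vy_eq)

text \<open>Incompressibility makes \<open>ux\<close> the \<open>y\<close>-derivative of
  \<open>- v\<close>, and \<open>v\<close> vanishes at both walls.\<close>

lemma ux_mean_zero:
  assumes t: "t \<in> time_dom Tm"
  shows "(ux t x has_integral 0) {0..1}"
proof -
  have "(ux t x has_integral - v t x 1 - - v t x 0) {0..1}"
    using DERIV_minus[OF deriv_v[OF t]]
    by (intro fundamental_theorem_of_calculus)
      (auto simp: has_real_derivative_iff_has_vector_derivative[symmetric])
  then show ?thesis by (simp add: v_top v_bottom t)
qed

text \<open>The \<open>x\<close>-derivative of the flux is the integral of \<open>ux\<close>, which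
  is zero.\<close>

lemma u_mean:
  assumes t: "t \<in> time_dom Tm"
  shows "(u t x has_integral c t) {0..1}"
proof -
  have "continuous_on (UNIV \<times> {0..1}) (\<lambda>(x, y). ux t x y)"
    unfolding split_beta using t by (intro U.continuous_comp) (auto intro!: continuous_intros)
  then have "((\<lambda>x. integral {0..1} (u t x)) has_real_derivative integral {0..1} (ux t x)) (at x)" for x
    using leibniz_rule_field_derivative[of UNIV 0 1 "u t" "ux t" x]
      U.deriv_x[OF t] integrable_continuous_real[OF U.continuous_y[OF t]]
    by simp
  then have "integral {0..1} (u t x) = c t"
    unfolding c_def
    by (intro DERIV_isconst_all[where f = "\<lambda>x. integral {0..1} (u t x)"])
      (simp add: integral_unique[OF ux_mean_zero[OF t]])
  then show ?thesis
    using integrable_integral[OF integrable_continuous_real[OF U.continuous_y[OF t]]] by metis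
qed

definition c' :: "real \<Rightarrow> real" where
  "c' t = integral {0..1} (U (Suc 0) 0 0 t 0)"

lemma deriv_c:
  assumes t: "t \<in> time_dom Tm"
  shows "(c has_real_derivative c' t) (at t within {0..})"
proof -
  obtain T where T: "t < T" "T \<in> time_dom Tm" using t by (rule time_dom_later)
  have sub: "{0..T} \<subseteq> time_dom Tm" using T by (intro time_dom_Icc)
  have t0: "0 \<le> t" using t by (simp add: time_dom_def)
  have "continuous_on ({0..T} \<times> {0..1}) (\<lambda>(s, y). U (Suc 0) 0 0 s 0 y)"
    unfolding split_beta using sub by (intro U.continuous_comp) (auto intro!: continuous_intros)
  moreover have "((\<lambda>s. u s 0 y) has_real_derivative U (Suc 0) 0 0 s 0 y) (at s within {0..T})"
    if "s \<in> {0..T}" "y \<in> {0..1}" for s y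
    using that sub by (intro has_field_derivative_subset[OF U.deriv_t]) auto
  moreover have "u s 0 integrable_on {0..1}" if "s \<in> {0..T}" for s
    using that sub by (intro integrable_continuous_real U.continuous_y) auto
  ultimately have "(c has_real_derivative c' t) (at t within {0..T})"
    using leibniz_rule_field_derivative[of "{0..T}" 0 1 "\<lambda>s. u s 0" "\<lambda>s. U (Suc 0) 0 0 s 0" t] t0 T
    unfolding c_def[abs_def] c'_def by simp
  then show ?thesis using T by (intro deriv_within_Icc_imp_Ici)
qed

lemma deriv_X:
  assumes t: "t \<in> time_dom Tm"
  shows "(X has_real_derivative c t) (at t within {0..})"
proof -
  obtain T where T: "t < T" "T \<in> time_dom Tm" using t by (rule time_dom_later)
  have sub: "{0..T} \<subseteq> time_dom Tm" using T by (intro time_dom_Icc)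
  have t0: "0 \<le> t" using t by (simp add: time_dom_def)
  have "(c has_real_derivative c' s) (at s within {0..T})" if "s \<in> {0..T}" for s
    using that sub by (intro has_field_derivative_subset[OF deriv_c]) auto
  then have "continuous_on {0..T} c" by (rule DERIV_continuous_on)
  from integral_has_real_derivative[OF this, of t] T t0
  have "(X has_real_derivative c t) (at t within {0..T})"
    unfolding X_def[abs_def] by (auto intro!: derivative_eq_intros)
  then show ?thesis using T by (intro deriv_within_Icc_imp_Ici)
qed

lemma continuous_c: "continuous_on (time_dom Tm) c"
  by (rule DERIV_continuous_on, rule has_field_derivative_subset[OF deriv_c])
    (auto simp: time_dom_def)

lemma continuous_c': "continuous_on (time_dom Tm) c'"
proof -
  have "continuous_on (time_dom Tm \<times> {0..1}) (\<lambda>(s, y). U (Suc 0) 0 0 s 0 y)"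
    unfolding split_beta by (intro U.continuous_comp) (auto intro!: continuous_intros)
  then show ?thesis
    unfolding c'_def[abs_def]
    using integral_continuous_on_param[of "time_dom Tm" 0 1 "\<lambda>s. U (Suc 0) 0 0 s 0"] by simp
qed

lemma continuous_X: "continuous_on (time_dom Tm) X"
  by (rule DERIV_continuous_on, rule has_field_derivative_subset[OF deriv_X])
    (auto simp: time_dom_def)

lemma X_bounded:
  assumes "T \<in> time_dom Tm"
  obtains R where "\<And>t. t \<in> {0..T} \<Longrightarrow> X t \<in> {-R..R}"
proof -
  have "compact (X ` {0..T})"
    using time_dom_Icc[OF assms]
    by (intro compact_continuous_image continuous_on_subset[OF continuous_X]) auto
  then obtain R where "\<forall>x\<in>X ` {0..T}. norm x \<le> R"
    using compact_imp_bounded bounded_iff by metis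
  then show thesis by (intro that[of R]) (force simp: abs_le_iff)
qed

lemma continuous_column_U:
  assumes "T \<in> time_dom Tm"
  shows "continuous_on ({0..T} \<times> {0..1}) (\<lambda>z. U i j k (fst z) (X (fst z)) (snd z))"
  using time_dom_Icc[OF assms]
  by (intro U.continuous_comp) (auto intro!: continuous_intros continuous_on_compose2[OF continuous_X])

lemma continuous_column_V:
  assumes "T \<in> time_dom Tm"
  shows "continuous_on ({0..T} \<times> {0..1}) (\<lambda>z. V i j k (fst z) (X (fst z)) (snd z))"
  using time_dom_Icc[OF assms]
  by (intro V.continuous_comp) (auto intro!: continuous_intros continuous_on_compose2[OF continuous_X])

lemma column_bounded:
  assumes T: "T \<in> time_dom Tm"
  obtains K where "\<And>t y. t \<in> {0..T} \<Longrightarrow> y \<in> {0..1} \<Longrightarrow> \<bar>U i j k t (X t) y\<bar> \<le> K"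
proof -
  obtain R where "\<And>t. t \<in> {0..T} \<Longrightarrow> X t \<in> {-R..R}" using T by (rule X_bounded) blast
  moreover obtain K where "\<And>t x y. t \<in> {0..T} \<Longrightarrow> x \<in> {-R..R} \<Longrightarrow> y \<in> {0..1} \<Longrightarrow> \<bar>U i j k t x y\<bar> \<le> K"
    using U.bounded_on_compact[OF T] by metis
  ultimately show thesis by (intro that[of K]) blast
qed

text \<open>Since \<open>u - c\<close> has mean zero over the column, the pressure gradient drops out of the energy
  \<open>\<integral> (u - c)\<^sup>2\<close>.\<close>

lemma u_column:
  assumes t: "t \<in> time_dom Tm" and y: "y \<in> {0..1}"
  shows "u t (X t) y = c t"
proof -
  have t0: "0 \<le> t" using t by (simp add: time_dom_def)
  have sub: "s \<in> time_dom Tm" if "s \<in> {0..t}" for s using time_dom_Icc[OF t] that by blast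
  obtain K where K: "\<And>s y. s \<in> {0..t} \<Longrightarrow> y \<in> {0..1} \<Longrightarrow> \<bar>ux s (X s) y\<bar> \<le> K"
    using column_bounded[OF t] by metis
  have cc: "continuous_on ({0..t} \<times> {0..1}) (\<lambda>z. c (fst z))"
    "continuous_on ({0..t} \<times> {0..1}) (\<lambda>z. c' (fst z))"
    using sub by (auto intro!: continuous_intros continuous_on_compose2[OF continuous_c]
        continuous_on_compose2[OF continuous_c'])
  define e where "e s y = u s (X s) y - c s" for s y
  define et where "et s y = U (Suc 0) 0 0 s (X s) y + c s * ux s (X s) y - c' s" for s y
  have "(e t y)\<^sup>2 = 0"
  proof (rule energy_vanishes[where f = "\<lambda>s y. (e s y)\<^sup>2" and ft = "\<lambda>s y. 2 * e s y * et s y"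
        and fy = "\<lambda>s y. 2 * e s y * uy s (X s) y" and v = "\<lambda>s. v s (X s)"
        and vy = "\<lambda>s. V 0 0 (Suc 0) s (X s)" and T = t and L = "2 * K"
        and g = "\<lambda>s y. - 2 * (P 0 (Suc 0) 0 s (X s) 0 + c' s) * e s y"])
    show "continuous_on ({0..t} \<times> {0..1}) (\<lambda>(s, y). (e s y)\<^sup>2)"
      unfolding e_def split_beta by (intro continuous_intros cc continuous_column_U t)
    show "continuous_on ({0..t} \<times> {0..1}) (\<lambda>(s, y). 2 * e s y * et s y)"
      unfolding e_def et_def split_beta by (intro continuous_intros cc continuous_column_U t)
    show "continuous_on ({0..t} \<times> {0..1}) (\<lambda>(s, y). 2 * e s y * uy s (X s) y)"
      unfolding e_def split_beta by (intro continuous_intros cc continuous_column_U t)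
    show "continuous_on ({0..t} \<times> {0..1}) (\<lambda>(s, y). v s (X s) y)"
      "continuous_on ({0..t} \<times> {0..1}) (\<lambda>(s, y). V 0 0 (Suc 0) s (X s) y)"
      unfolding split_beta by (intro continuous_column_V t)+
    show "(e 0 y)\<^sup>2 = 0" if "y \<in> {0..1}" for y
    proof -
      have "(u 0 xh has_integral uh) {0..1}"
        using has_integral_eq[of "{0..1}" "\<lambda>_. uh" "u 0 xh" uh] init_u
          has_integral_const_real[of uh 0 1] by simp
      then have "c 0 = uh"
        using u_mean[of 0 xh] time_dom_0[OF Tm_pos] has_integral_unique by blast
      with that show ?thesis by (simp add: e_def X_0 init_u)
    qed
  next
    fix s y assume s: "s \<in> {0..t}" and y: "y \<in> {0..(1::real)}"
    have "((\<lambda>s. e s y) has_real_derivative et s y) (at s within {0..})"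
      unfolding e_def et_def
      by (intro DERIV_diff U.deriv_along deriv_X deriv_c sub s y)
    then have "((\<lambda>s. e s y) has_real_derivative et s y) (at s within {0..t})"
      by (rule has_field_derivative_subset) auto
    then show "((\<lambda>s. (e s y)\<^sup>2) has_real_derivative 2 * e s y * et s y) (at s within {0..t})"
      by (auto intro!: derivative_eq_intros)
    have "(e s has_real_derivative uy s (X s) y) (at y within {0..1})"
      unfolding e_def using U.deriv_y[OF sub[OF s] y]
      by (auto intro!: derivative_eq_intros)
    then show "((\<lambda>y. (e s y)\<^sup>2) has_real_derivative 2 * e s y * uy s (X s) y) (at y within {0..1})"
      by (auto intro!: derivative_eq_intros)
    \<comment> \<open>Writing \<open>u = c + e\<close> in the advection term cancels the
      \<open>c * ux\<close> contained in \<open>et\<close>. The last two terms are constant in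
      \<open>y\<close>; multiplied by \<open>2 * e\<close> they form the source with zero
      integral.\<close>
    have et_eq: "et s y = - e s y * ux s (X s) y - v s (X s) y * uy s (X s) y
        - P 0 (Suc 0) 0 s (X s) 0 - c' s"
      using momentum[OF sub[OF s] y, of "X s"] by (simp add: et_def e_def algebra_simps)
    have "2 * e s y * et s y + v s (X s) y * (2 * e s y * uy s (X s) y)
        = 2 * (- ux s (X s) y * (e s y)\<^sup>2) + - 2 * (P 0 (Suc 0) 0 s (X s) 0 + c' s) * e s y"
      unfolding et_eq by (simp add: power2_eq_square algebra_simps)
    also have "- ux s (X s) y * (e s y)\<^sup>2 \<le> K * (e s y)\<^sup>2"
      using K[OF s y] by (intro mult_right_mono) auto
    finally show "2 * e s y * et s y + v s (X s) y * (2 * e s y * uy s (X s) y)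
        \<le> 2 * K * (e s y)\<^sup>2 + - 2 * (P 0 (Suc 0) 0 s (X s) 0 + c' s) * e s y"
      by simp
  next
    fix s assume s: "s \<in> {0..t}"
    have "((\<lambda>_. c s) has_integral c s) {0..(1::real)}"
      using has_integral_const_real[of "c s" 0 1] by simp
    from has_integral_diff[OF u_mean[OF sub[OF s], of "X s"] this]
    have "(e s has_integral 0) {0..1}" by (simp add: e_def[abs_def])
    from has_integral_mult_right[OF this]
    show "((\<lambda>y. - 2 * (P 0 (Suc 0) 0 s (X s) 0 + c' s) * e s y) has_integral 0) {0..1}"
      by (metis mult_zero_right)
    show "v s (X s) 0 = 0 \<and> v s (X s) 1 = 0"
      using sub[OF s] by (simp add: v_top v_bottom)
  next
    show "(v s (X s) has_real_derivative V 0 0 (Suc 0) s (X s) y) (at y within {0..1})"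
      if "s \<in> {0..t}" "y \<in> {0..1}" for s y
      using that by (intro V.deriv_y sub)
  qed (use t0 y in auto)
  then show ?thesis by (simp add: e_def)
qed

section \<open>Equations for \<open>ux\<close>, \<open>uxy\<close> and \<open>uxyy\<close> on the
  column\<close>

text \<open>Constancy of \<open>u\<close> on the column; it removes the term with the
  \<open>x\<close>-derivative of \<open>v\<close> from \<open>momentum_x\<close>.\<close>

lemma uy_column:
  assumes t: "t \<in> time_dom Tm" and y: "y \<in> {0..1}"
  shows "uy t (X t) y = 0"
  by (rule deriv_eq_of_eq_on_Icc[OF _ y U.deriv_y[OF t y] DERIV_const[of "c t"]])
    (simp_all add: u_column t)

lemma momentum_x:
  assumes t: "t \<in> time_dom Tm" and y: "y \<in> {0..1}"
  shows "U (Suc 0) (Suc 0) 0 t x y + (ux t x y)\<^sup>2 + u t x y * U 0 (Suc (Suc 0)) 0 t x y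
      + V 0 (Suc 0) 0 t x y * uy t x y + v t x y * uxy t x y = - P 0 (Suc (Suc 0)) 0 t x 0"
proof -
  have "((\<lambda>x. U (Suc 0) 0 0 t x y + u t x y * ux t x y + v t x y * uy t x y) has_real_derivative
      U (Suc 0) (Suc 0) 0 t x y + (ux t x y)\<^sup>2 + u t x y * U 0 (Suc (Suc 0)) 0 t x y
      + V 0 (Suc 0) 0 t x y * uy t x y + v t x y * uxy t x y) (at x)"
    by (auto intro!: derivative_eq_intros U.deriv_x V.deriv_x t y
        simp: power2_eq_square algebra_simps)
  moreover have "((\<lambda>x. U (Suc 0) 0 0 t x y + u t x y * ux t x y + v t x y * uy t x y)
      has_real_derivative - P 0 (Suc (Suc 0)) 0 t x 0) (at x)"
    unfolding momentum[OF t y] by (intro DERIV_minus P.deriv_x t) simp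
  ultimately show ?thesis by (rule DERIV_unique)
qed

text \<open>Since \<open>u = c\<close> on the column, the first two terms are the derivative of
  \<open>ux\<close> along \<open>X\<close>, in the form given by
  \<open>U.deriv_along\<close>.\<close>

lemma ux_column:
  assumes t: "t \<in> time_dom Tm" and y: "y \<in> {0..1}"
  shows "U (Suc 0) (Suc 0) 0 t (X t) y + c t * U 0 (Suc (Suc 0)) 0 t (X t) y
      + (ux t (X t) y)\<^sup>2 + v t (X t) y * uxy t (X t) y = - P 0 (Suc (Suc 0)) 0 t (X t) 0"
  using momentum_x[OF t y, of "X t"] unfolding u_column[OF t y] uy_column[OF t y] by simp

text \<open>In the \<open>y\<close>-derivative of \<open>ux_column\<close> the pressure disappears,
  and \<open>- ux * uxy\<close> from differentiating \<open>v\<close> cancels half of the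
  contribution of the square.\<close>

lemma uxy_column:
  assumes t: "t \<in> time_dom Tm" and y: "y \<in> {0..1}"
  shows "U (Suc 0) (Suc 0) (Suc 0) t (X t) y + c t * U 0 (Suc (Suc 0)) (Suc 0) t (X t) y
      + v t (X t) y * uxyy t (X t) y = - ux t (X t) y * uxy t (X t) y"
proof -
  have "((\<lambda>y. U (Suc 0) (Suc 0) 0 t (X t) y + c t * U 0 (Suc (Suc 0)) 0 t (X t) y
      + (ux t (X t) y)\<^sup>2 + v t (X t) y * uxy t (X t) y) has_real_derivative
      U (Suc 0) (Suc 0) (Suc 0) t (X t) y + c t * U 0 (Suc (Suc 0)) (Suc 0) t (X t) y
      + 2 * ux t (X t) y * uxy t (X t) y
      + (- ux t (X t) y * uxy t (X t) y + v t (X t) y * uxyy t (X t) y)) (at y within {0..1})"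
    by (auto intro!: derivative_eq_intros U.deriv_y deriv_v t y)
  from deriv_eq_of_eq_on_Icc[OF _ y this DERIV_const[of "- P 0 (Suc (Suc 0)) 0 t (X t) 0"]]
  show ?thesis by (simp add: ux_column t)
qed

text \<open>Differentiating once more produces \<open>- ux * uxyy\<close> on both sides; what
  survives is a source with a sign.\<close>

lemma uxyy_column:
  assumes t: "t \<in> time_dom Tm" and y: "y \<in> {0..1}"
  shows "U (Suc 0) (Suc 0) (Suc (Suc 0)) t (X t) y + c t * U 0 (Suc (Suc 0)) (Suc (Suc 0)) t (X t) y
      + v t (X t) y * U 0 (Suc 0) (Suc (Suc (Suc 0))) t (X t) y = - (uxy t (X t) y)\<^sup>2"
proof -
  have d1: "((\<lambda>y. U (Suc 0) (Suc 0) (Suc 0) t (X t) y + c t * U 0 (Suc (Suc 0)) (Suc 0) t (X t) y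
      + v t (X t) y * uxyy t (X t) y) has_real_derivative
      U (Suc 0) (Suc 0) (Suc (Suc 0)) t (X t) y + c t * U 0 (Suc (Suc 0)) (Suc (Suc 0)) t (X t) y
      + (- ux t (X t) y * uxyy t (X t) y + v t (X t) y * U 0 (Suc 0) (Suc (Suc (Suc 0))) t (X t) y))
      (at y within {0..1})"
    by (auto intro!: derivative_eq_intros U.deriv_y deriv_v t y)
  have d2: "((\<lambda>y. - ux t (X t) y * uxy t (X t) y) has_real_derivative
      - ux t (X t) y * uxyy t (X t) y - (uxy t (X t) y)\<^sup>2) (at y within {0..1})"
    by (auto intro!: derivative_eq_intros U.deriv_y t y simp: power2_eq_square)
  show ?thesis
    using deriv_eq_of_eq_on_Icc[OF _ y d1 d2] by (simp add: uxy_column t)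
qed

section \<open>Monotonicity and concavity of \<open>ux\<close> in \<open>y\<close> persist\<close>

text \<open>Continuity carries the weak inequality to the two walls, as
  \<open>transport_nonpos\<close> requires.\<close>

lemma init_uxyy_le:
  assumes y: "y \<in> {0..1}"
  shows "uxyy 0 xh y \<le> 0"
proof (rule continuous_le_on_closure[where f = "uxyy 0 xh" and S = "{0<..<1}"])
  show "continuous_on (closure {0<..<1}) (uxyy 0 xh)"
    using U.continuous_y[OF time_dom_0[OF Tm_pos]] by simp
qed (use y init_uxyy in \<open>auto intro: less_imp_le\<close>)

text \<open>Since \<open>uxy\<close> starts from zero at the bottom by \<open>init_uxy\<close>,
  concavity gives its sign.\<close>

lemma init_uxy_le:
  assumes y: "y \<in> {0..1}"
  shows "uxy 0 xh y \<le> 0"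
proof -
  have "- uxy 0 xh 0 \<le> - uxy 0 xh y"
  proof (rule mono_of_deriv_within[where f = "\<lambda>y. - uxy 0 xh y" and f' = "\<lambda>y. - uxyy 0 xh y"])
    fix s assume "s \<in> {0..y}"
    with y have s: "s \<in> {0..1}" by auto
    show "((\<lambda>y. - uxy 0 xh y) has_real_derivative - uxyy 0 xh s) (at s within {0..y})"
      using y by (intro DERIV_minus has_field_derivative_subset[OF U.deriv_y] time_dom_0 Tm_pos s) auto
    show "0 \<le> - uxyy 0 xh s" using init_uxyy_le[OF s] by simp
  qed (use y in auto)
  then show ?thesis by (simp add: init_uxy)
qed

text \<open>Equation \<open>uxy_column\<close> is linear and homogeneous in \<open>uxy\<close>, with
  coefficient \<open>- ux\<close> bounded on compact time intervals, so the sign is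
  transported.\<close>

lemma uxy_column_le:
  assumes t: "t \<in> time_dom Tm" and y: "y \<in> {0..1}"
  shows "uxy t (X t) y \<le> 0"
proof -
  have t0: "0 \<le> t" using t by (simp add: time_dom_def)
  have sub: "s \<in> time_dom Tm" if "s \<in> {0..t}" for s using time_dom_Icc[OF t] that by blast
  obtain K where K: "\<And>s y. s \<in> {0..t} \<Longrightarrow> y \<in> {0..1} \<Longrightarrow> \<bar>ux s (X s) y\<bar> \<le> K"
    using column_bounded[OF t] by metis
  have cc: "continuous_on ({0..t} \<times> {0..1}) (\<lambda>z. c (fst z))"
    using sub by (auto intro!: continuous_intros continuous_on_compose2[OF continuous_c])
  show ?thesis
  proof (rule transport_nonpos[where q = "\<lambda>s. uxy s (X s)" and T = t
      and qt = "\<lambda>s y. U (Suc 0) (Suc 0) (Suc 0) s (X s) y + c s * U 0 (Suc (Suc 0)) (Suc 0) s (X s) y"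
      and qy = "\<lambda>s. uxyy s (X s)" and v = "\<lambda>s. v s (X s)"
      and vy = "\<lambda>s. V 0 0 (Suc 0) s (X s)" and r = "\<lambda>s y. - ux s (X s) y" and K = K])
    fix s y assume s: "s \<in> {0..t}" and y: "y \<in> {0..(1::real)}"
    show "((\<lambda>s. uxy s (X s) y) has_real_derivative
        U (Suc 0) (Suc 0) (Suc 0) s (X s) y + c s * U 0 (Suc (Suc 0)) (Suc 0) s (X s) y)
        (at s within {0..t})"
      by (rule has_field_derivative_subset[OF U.deriv_along[OF sub[OF s] y deriv_X[OF sub[OF s]]]])
        auto
    show "- ux s (X s) y \<le> K" using K[OF s y] by simp
    show "(uxy s (X s) has_real_derivative uxyy s (X s) y) (at y within {0..1})"
      by (intro U.deriv_y sub s y)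
    show "(v s (X s) has_real_derivative V 0 0 (Suc 0) s (X s) y) (at y within {0..1})"
      by (intro V.deriv_y sub s y)
    show "U (Suc 0) (Suc 0) (Suc 0) s (X s) y + c s * U 0 (Suc (Suc 0)) (Suc 0) s (X s) y + v s (X s) y * uxyy s (X s) y
        \<le> - ux s (X s) y * uxy s (X s) y"
      using uxy_column[OF sub[OF s] y] by simp
  next
    show "v s (X s) 0 = 0 \<and> v s (X s) 1 = 0" if "s \<in> {0..t}" for s
      using sub[OF that] by (simp add: v_top v_bottom)
    show "uxy 0 (X 0) y \<le> 0" if "y \<in> {0..1}" for y
      using init_uxy_le[OF that] by (simp add: X_0)
    show "continuous_on ({0..t} \<times> {0..1}) (\<lambda>(s, y). U (Suc 0) (Suc 0) (Suc 0) s (X s) y + c s * U 0 (Suc (Suc 0)) (Suc 0) s (X s) y)"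
      unfolding split_beta by (intro continuous_intros continuous_column_U t cc)
  qed (unfold split_beta, (intro continuous_column_U continuous_column_V t t0 y)+, use t0 y in auto)
qed

text \<open>The source in \<open>uxyy_column\<close> is minus a square, so the coefficient
  \<open>r\<close> can be taken as zero.\<close>

lemma uxyy_column_le:
  assumes t: "t \<in> time_dom Tm" and y: "y \<in> {0..1}"
  shows "uxyy t (X t) y \<le> 0"
proof -
  have t0: "0 \<le> t" using t by (simp add: time_dom_def)
  have sub: "s \<in> time_dom Tm" if "s \<in> {0..t}" for s using time_dom_Icc[OF t] that by blast
  have cc: "continuous_on ({0..t} \<times> {0..1}) (\<lambda>z. c (fst z))"
    using sub by (auto intro!: continuous_intros continuous_on_compose2[OF continuous_c])
  show ?thesis
  proof (rule transport_nonpos[where q = "\<lambda>s. uxyy s (X s)" and T = t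
      and qt = "\<lambda>s y. U (Suc 0) (Suc 0) (Suc (Suc 0)) s (X s) y
        + c s * U 0 (Suc (Suc 0)) (Suc (Suc 0)) s (X s) y"
      and qy = "\<lambda>s. U 0 (Suc 0) (Suc (Suc (Suc 0))) s (X s)" and v = "\<lambda>s. v s (X s)"
      and vy = "\<lambda>s. V 0 0 (Suc 0) s (X s)" and r = "\<lambda>_ _. 0" and K = 0])
    fix s y assume s: "s \<in> {0..t}" and y: "y \<in> {0..(1::real)}"
    show "((\<lambda>s. uxyy s (X s) y) has_real_derivative
        U (Suc 0) (Suc 0) (Suc (Suc 0)) s (X s) y + c s * U 0 (Suc (Suc 0)) (Suc (Suc 0)) s (X s) y)
        (at s within {0..t})"
      by (rule has_field_derivative_subset[OF U.deriv_along[OF sub[OF s] y deriv_X[OF sub[OF s]]]])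
        auto
    show "(uxyy s (X s) has_real_derivative U 0 (Suc 0) (Suc (Suc (Suc 0))) s (X s) y) (at y within {0..1})"
      by (intro U.deriv_y sub s y)
    show "(v s (X s) has_real_derivative V 0 0 (Suc 0) s (X s) y) (at y within {0..1})"
      by (intro V.deriv_y sub s y)
    show "U (Suc 0) (Suc 0) (Suc (Suc 0)) s (X s) y + c s * U 0 (Suc (Suc 0)) (Suc (Suc 0)) s (X s) y + v s (X s) y * U 0 (Suc 0) (Suc (Suc (Suc 0))) s (X s) y
        \<le> 0 * uxyy s (X s) y"
      using uxyy_column[OF sub[OF s] y] by simp
  next
    show "v s (X s) 0 = 0 \<and> v s (X s) 1 = 0" if "s \<in> {0..t}" for s
      using sub[OF that] by (simp add: v_top v_bottom)
    show "uxyy 0 (X 0) y \<le> 0" if "y \<in> {0..1}" for y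
      using init_uxyy_le[OF that] by (simp add: X_0)
    show "continuous_on ({0..t} \<times> {0..1}) (\<lambda>(s, y). U (Suc 0) (Suc 0) (Suc (Suc 0)) s (X s) y + c s * U 0 (Suc (Suc 0)) (Suc (Suc 0)) s (X s) y)"
      unfolding split_beta by (intro continuous_intros continuous_column_U t cc)
  qed (unfold split_beta, (intro continuous_column_U continuous_column_V t t0 y)+, use t0 y in auto)
qed

lemma column_profile:
  assumes t: "t \<in> time_dom Tm"
  shows "integral {0..1} (\<lambda>y. (ux t (X t) y)\<^sup>2) \<le> (ux t (X t) 1)\<^sup>2 / 3"
    and "\<And>y. y \<in> {0..1} \<Longrightarrow> \<bar>ux t (X t) y\<bar> \<le> - ux t (X t) 1"
proof -
  have anti: "uxy t (X t) y \<le> uxy t (X t) x" if xy: "0 \<le> x" "x \<le> y" "y \<le> 1" for x y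
  proof -
    have "- uxy t (X t) x \<le> - uxy t (X t) y"
    proof (rule mono_of_deriv_within[where f = "\<lambda>y. - uxy t (X t) y"
          and f' = "\<lambda>y. - uxyy t (X t) y"])
      fix s assume "s \<in> {x..y}"
      with xy have s: "s \<in> {0..1}" by auto
      show "((\<lambda>y. - uxy t (X t) y) has_real_derivative - uxyy t (X t) s) (at s within {x..y})"
        using xy by (intro DERIV_minus has_field_derivative_subset[OF U.deriv_y] t s) auto
      show "0 \<le> - uxyy t (X t) s" using uxyy_column_le[OF t s] by simp
    qed (use xy in auto)
    then show ?thesis by simp
  qed
  note * = concave_mean_zero_bounds[OF U.deriv_y[OF t] U.continuous_y[OF t] uxy_column_le[OF t]
      anti ux_mean_zero[OF t]]
  show "integral {0..1} (\<lambda>y. (ux t (X t) y)\<^sup>2) \<le> (ux t (X t) 1)\<^sup>2 / 3"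
    and "\<And>y. y \<in> {0..1} \<Longrightarrow> \<bar>ux t (X t) y\<bar> \<le> - ux t (X t) 1"
    using * by auto
qed

end

section \<open>Riccati inequality, finite lifespan and uniqueness of characteristics\<close>

context hydrostatic_column
begin

text \<open>The Lagrangian velocity gradient at the top boundary blows up because the quadratic term
  beats the pressure \<open>- p_xx = 2 * \<integral> ux\<^sup>2\<close>, which the concave profile bounds by \<open>2 / 3 * ux\<^sup>2\<close>.\<close>

definition m :: "real \<Rightarrow> real" where
  "m t = - ux t (X t) 1"

definition m' :: "real \<Rightarrow> real" where
  "m' t = - (U (Suc 0) (Suc 0) 0 t (X t) 1 + c t * U 0 (Suc (Suc 0)) 0 t (X t) 1)"

lemma deriv_m:
  "t \<in> time_dom Tm \<Longrightarrow> (m has_real_derivative m' t) (at t within {0..})"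
  unfolding m_def[abs_def] m'_def
  by (intro DERIV_minus U.deriv_along deriv_X) auto

text \<open>Averaging \<open>ux_column\<close> over the height: the derivative along
  \<open>X\<close> has mean zero because \<open>ux\<close> does at all times, and integrating
  \<open>v * uxy\<close> by parts gives a second copy of the integral of the square of
  \<open>ux\<close>.\<close>

lemma pressure_column:
  assumes t: "t \<in> time_dom Tm"
  shows "- P 0 (Suc (Suc 0)) 0 t (X t) 0 = 2 * integral {0..1} (\<lambda>y. (ux t (X t) y)\<^sup>2)"
proof -
  define wt where "wt s y = U (Suc 0) (Suc 0) 0 s (X s) y + c s * U 0 (Suc (Suc 0)) 0 s (X s) y" for s y
  define I where "I = integral {0..1} (\<lambda>y. (ux t (X t) y)\<^sup>2)"
  obtain T where T: "t < T" "T \<in> time_dom Tm" using t by (rule time_dom_later)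
  have sub: "s \<in> time_dom Tm" if "s \<in> {0..T}" for s using time_dom_Icc[OF T(2)] that by blast
  have tT: "t \<in> {0..T}" using T t by (simp add: time_dom_def)
  have i1: "integral {0..1} (wt t) = 0"
  proof -
    have cc: "continuous_on ({0..T} \<times> {0..1}) (\<lambda>z. c (fst z))"
      using sub by (auto intro!: continuous_intros continuous_on_compose2[OF continuous_c])
    have cw: "continuous_on ({0..T} \<times> {0..1}) (\<lambda>(s, y). wt s y)"
      unfolding wt_def case_prod_unfold by (intro continuous_intros cc continuous_column_U T)
    have dw: "((\<lambda>s. ux s (X s) y) has_real_derivative wt s y) (at s within {0..T})"
      if "s \<in> {0..T}" "y \<in> {0..1}" for s y
      unfolding wt_def
      by (rule has_field_derivative_subset[OF U.deriv_along[OF sub[OF that(1)] that(2) deriv_X[OF sub[OF that(1)]]]])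
        auto
    have ii: "ux s (X s) integrable_on {0..1}" if "s \<in> {0..T}" for s
      using ux_mean_zero[OF sub[OF that]] by (rule has_integral_integrable)
    have "((\<lambda>s. integral {0..1} (ux s (X s))) has_real_derivative integral {0..1} (wt t))
        (at t within {0..T})"
      using leibniz_rule_field_derivative[of "{0..T}" 0 1 "\<lambda>s. ux s (X s)" wt t] dw ii cw tT by simp
    from deriv_eq_of_eq_on_Icc[OF _ tT this DERIV_const[of 0]] T tT
    show ?thesis by (auto simp: integral_unique[OF ux_mean_zero[OF sub]])
  qed
  have "continuous_on {0..1} (wt t)"
    unfolding wt_def by (intro continuous_intros U.continuous_y t)
  then have i2: "(wt t has_integral 0) {0..1}"
    using integrable_integral[OF integrable_continuous_real] i1 by metis
  have i3: "((\<lambda>y. (ux t (X t) y)\<^sup>2) has_integral I) {0..1}"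
    unfolding I_def
    by (intro integrable_integral integrable_continuous_real continuous_intros U.continuous_y t)
  have i4: "((\<lambda>y. - (ux t (X t) y)\<^sup>2 + v t (X t) y * uxy t (X t) y) has_integral 0) {0..1}"
  proof -
    have "((\<lambda>y. - (ux t (X t) y)\<^sup>2 + v t (X t) y * uxy t (X t) y) has_integral
        v t (X t) 1 * ux t (X t) 1 - v t (X t) 0 * ux t (X t) 0) {0..1}"
      by (rule fundamental_theorem_of_calculus)
        (auto intro!: derivative_eq_intros deriv_v U.deriv_y t
          simp: has_real_derivative_iff_has_vector_derivative[symmetric] power2_eq_square)
    then show ?thesis by (simp add: v_top v_bottom t)
  qed
  \<comment> \<open>The left side of \<open>ux_column\<close> is split so that the last bracket is
    the \<open>y\<close>-derivative of \<open>v * ux\<close>.\<close>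
  have sum: "((\<lambda>y. wt t y + 2 * (ux t (X t) y)\<^sup>2 + (- (ux t (X t) y)\<^sup>2 + v t (X t) y * uxy t (X t) y))
      has_integral 0 + 2 * I + 0) {0..1}"
    by (intro has_integral_add has_integral_mult_right i2 i3 i4)
  have eq: "wt t y + 2 * (ux t (X t) y)\<^sup>2 + (- (ux t (X t) y)\<^sup>2 + v t (X t) y * uxy t (X t) y)
      = - P 0 (Suc (Suc 0)) 0 t (X t) 0" if "y \<in> {0..1}" for y
    using ux_column[OF t that] by (simp add: wt_def)
  have "((\<lambda>_. - P 0 (Suc (Suc 0)) 0 t (X t) 0) has_integral 0 + 2 * I + 0) {0..(1::real)}"
    using eq sum by (rule has_integral_eq)
  then have "((\<lambda>_. - P 0 (Suc (Suc 0)) 0 t (X t) 0) has_integral 2 * I) {0..(1::real)}"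
    by simp
  moreover have "((\<lambda>_. - P 0 (Suc (Suc 0)) 0 t (X t) 0) has_integral - P 0 (Suc (Suc 0)) 0 t (X t) 0) {0..(1::real)}"
    using has_integral_const_real[of "- P 0 (Suc (Suc 0)) 0 t (X t) 0" 0 1] by simp
  ultimately show ?thesis unfolding I_def by (rule has_integral_unique[symmetric])
qed

text \<open>At the top wall \<open>v = 0\<close>, so only the square and the pressure remain in
  \<open>ux_column\<close>.\<close>

lemma m'_ge:
  assumes t: "t \<in> time_dom Tm"
  shows "(m t)\<^sup>2 / 3 \<le> m' t"
  using ux_column[OF t, of 1] pressure_column[OF t] column_profile(1)[OF t] v_top[OF t, of "X t"]
  by (simp add: m_def m'_def)

lemma ux_column_le_m:
  "t \<in> time_dom Tm \<Longrightarrow> y \<in> {0..1} \<Longrightarrow> \<bar>ux t (X t) y\<bar> \<le> m t"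
  using column_profile(2) by (simp add: m_def)

lemma m_mono:
  assumes t: "t \<in> time_dom Tm" and s: "0 \<le> s" "s \<le> t"
  shows "m s \<le> m t"
proof (rule mono_of_deriv_within[where f = m and f' = m'])
  fix r assume r: "r \<in> {s..t}"
  then have rt: "r \<in> time_dom Tm" using time_dom_Icc[OF t] s by auto
  show "(m has_real_derivative m' r) (at r within {s..t})"
    by (rule has_field_derivative_subset[OF deriv_m[OF rt]]) (use s in auto)
  show "0 \<le> m' r"
    using m'_ge[OF rt] by (rule order_trans[rotated]) simp
qed (use s in auto)

text \<open>Otherwise \<open>ux\<close> vanishes on the whole initial segment, and with it
  \<open>uxyy\<close>, against the strict inequality at the interior point
  \<open>1 / 2\<close>.\<close>

lemma m_0_pos: "0 < m 0"
proof (rule ccontr)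
  assume "\<not> 0 < m 0"
  note 0 = time_dom_0[OF Tm_pos]
  have z: "ux 0 xh y = 0" if "y \<in> {0..1}" for y
    using ux_column_le_m[OF 0 that] \<open>\<not> 0 < m 0\<close> by (simp add: X_0)
  have z': "uxy 0 xh y = 0" if y: "y \<in> {0..1}" for y
    by (rule deriv_eq_of_eq_on_Icc[OF _ y U.deriv_y[OF 0 y] DERIV_const[of 0]]) (simp_all add: z)
  have "uxyy 0 xh y = 0" if y: "y \<in> {0..1}" for y
    by (rule deriv_eq_of_eq_on_Icc[OF _ y U.deriv_y[OF 0 y] DERIV_const[of 0]]) (simp_all add: z')
  from this[of "1 / 2"] init_uxyy[of "1 / 2"] show False by simp
qed

text \<open>By the Riccati inequality \<open>- inverse (m s) - s / 3\<close> is nondecreasing, while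
  \<open>inverse (m t)\<close> stays positive.\<close>

lemma lifespan_less:
  assumes t: "t \<in> time_dom Tm"
  shows "t < 3 / m 0"
proof -
  have t0: "0 \<le> t" using t by (simp add: time_dom_def)
  have m_pos: "0 < m s" if "s \<in> {0..t}" for s
    using m_mono[of s 0] m_0_pos time_dom_Icc[OF t] that by fastforce
  have "- inverse (m 0) - 0 / 3 \<le> - inverse (m t) - t / 3"
  proof (rule mono_of_deriv_within[where f = "\<lambda>s. - inverse (m s) - s / 3"
        and f' = "\<lambda>s. m' s / (m s)\<^sup>2 - 1 / 3"])
    fix s assume s: "s \<in> {0..t}"
    then have st: "s \<in> time_dom Tm" using time_dom_Icc[OF t] by auto
    have "(m has_real_derivative m' s) (at s within {0..t})"
      by (rule has_field_derivative_subset[OF deriv_m[OF st]]) auto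
    then show "((\<lambda>s. - inverse (m s) - s / 3) has_real_derivative m' s / (m s)\<^sup>2 - 1 / 3) (at s within {0..t})"
      using m_pos[OF s] by (auto intro!: derivative_eq_intros simp: field_simps power2_eq_square)
    show "0 \<le> m' s / (m s)\<^sup>2 - 1 / 3"
      using m'_ge[OF st] m_pos[OF s] by (simp add: field_simps)
  qed (use t0 in auto)
  moreover have "0 < inverse (m t)" using m_pos[of t] t0 by simp
  ultimately have "t / 3 < inverse (m 0)" by linarith
  then show ?thesis using m_0_pos by (simp add: field_simps)
qed

text \<open>The bound \<open>gradient_bounded_from\<close> concerns every characteristic issuing
  from the segment. At each height \<open>Y' r\<close> the velocity on the column is
  \<open>c r\<close>, so the squared distance of \<open>X'\<close> from \<open>X\<close> obeys a
  Gronwall inequality with the Lipschitz constant of \<open>u\<close> in \<open>x\<close>.\<close>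

lemma characteristic_eq:
  assumes X'_0: "X' 0 = xh"
    and char: "\<And>t. t \<in> time_dom (ereal s) \<Longrightarrow> Y' t \<in> {0..1} \<and>
      (X' has_real_derivative u t (X' t) (Y' t)) (at t within {0..})"
    and s: "ereal s \<le> Tm" and t: "t \<in> time_dom (ereal s)"
  shows "X' t = X t"
proof -
  have t': "t \<in> time_dom Tm" using t s by (auto simp: time_dom_def intro: less_le_trans[of "ereal t" "ereal s"])
  have t0: "0 \<le> t" using t by (simp add: time_dom_def)
  have sub: "r \<in> time_dom Tm" "r \<in> time_dom (ereal s)" if "r \<in> {0..t}" for r
    using time_dom_Icc[OF t] time_dom_Icc[OF t'] that by auto
  have dX': "(X' has_real_derivative u r (X' r) (Y' r)) (at r within {0..t})" if "r \<in> {0..t}" for r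
    using char[OF sub(2)[OF that]] by (auto intro: has_field_derivative_subset)
  have dX: "(X has_real_derivative c r) (at r within {0..t})" if "r \<in> {0..t}" for r
    by (rule has_field_derivative_subset[OF deriv_X[OF sub(1)[OF that]]]) auto
  obtain R1 where R1: "\<And>r. r \<in> {0..t} \<Longrightarrow> X r \<in> {-R1..R1}" using t' by (rule X_bounded) blast
  obtain R2 where R2: "\<And>r. r \<in> {0..t} \<Longrightarrow> X' r \<in> {-R2..R2}"
  proof -
    have "compact (X' ` {0..t})"
      by (intro compact_continuous_image DERIV_continuous_on[OF dX']) auto
    then obtain R where "\<forall>x\<in>X' ` {0..t}. norm x \<le> R"
      using compact_imp_bounded bounded_iff by metis
    then show thesis by (intro that[of R]) (force simp: abs_le_iff)
  qed
  \<comment> \<open>One box contains both curves, so that \<open>K\<close> bounds \<open>ux\<close>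
    on the segments between them.\<close>
  define R where "R = max R1 R2"
  obtain K where K: "\<And>r x y. r \<in> {0..t} \<Longrightarrow> x \<in> {-R..R} \<Longrightarrow> y \<in> {0..1} \<Longrightarrow> \<bar>ux r x y\<bar> \<le> K"
    using U.bounded_on_compact[OF t'] by metis
  have "(X' t - X t)\<^sup>2 = 0"
  proof (rule gronwall_zero[where f = "\<lambda>r. (X' r - X r)\<^sup>2" and T = t and K = "2 * K"
        and f' = "\<lambda>r. 2 * (X' r - X r) * (u r (X' r) (Y' r) - c r)"])
    fix r assume r: "r \<in> {0..t}"
    show "((\<lambda>r. (X' r - X r)\<^sup>2) has_real_derivative
        2 * (X' r - X r) * (u r (X' r) (Y' r) - c r)) (at r within {0..t})"
      by (auto intro!: derivative_eq_intros dX dX' r)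
    have Y: "Y' r \<in> {0..1}" using char[OF sub(2)[OF r]] by simp
    have XR: "X r \<in> {-R..R}" "X' r \<in> {-R..R}"
      using R1[OF r] R2[OF r] by (auto simp: R_def)
    have "norm (u r (X' r) (Y' r) - u r (X r) (Y' r)) \<le> K * norm (X' r - X r)"
    proof (rule field_differentiable_bound[where S = "{-R..R}" and f' = "\<lambda>x. ux r x (Y' r)"])
      fix x assume x: "x \<in> {-R..R}"
      show "((\<lambda>x. u r x (Y' r)) has_real_derivative ux r x (Y' r)) (at x within {-R..R})"
        by (rule has_field_derivative_at_within[OF U.deriv_x[OF sub(1)[OF r] Y]])
      show "norm (ux r x (Y' r)) \<le> K" using K[OF r x Y] by simp
    qed (use XR in auto)
    then have "\<bar>u r (X' r) (Y' r) - c r\<bar> \<le> K * \<bar>X' r - X r\<bar>"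
      by (simp add: u_column[OF sub(1)[OF r] Y])
    then have "\<bar>X' r - X r\<bar> * \<bar>u r (X' r) (Y' r) - c r\<bar> \<le> \<bar>X' r - X r\<bar> * (K * \<bar>X' r - X r\<bar>)"
      by (rule mult_left_mono) simp
    also have "\<dots> = K * (X' r - X r)\<^sup>2"
      by (simp add: power2_eq_square flip: abs_mult)
    finally show "2 * (X' r - X r) * (u r (X' r) (Y' r) - c r) \<le> 2 * K * (X' r - X r)\<^sup>2"
      using abs_ge_self[of "(X' r - X r) * (u r (X' r) (Y' r) - c r)"]
      unfolding abs_mult mult.assoc by linarith
  qed (use t0 X'_0 X_0 in auto)
  then show ?thesis by simp
qed

end

section \<open>From the derivative operators of the statement to the family of partials\<close>

lemma smooth_on_strip_partials:
  assumes "smooth_on_strip Tm f"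
  obtains D where "smooth_partials Tm D"
    and "\<And>t x y. t \<in> time_dom Tm \<Longrightarrow> y \<in> {0..1} \<Longrightarrow> D 0 0 0 t x y = f t x y"
proof -
  from assms obtain D where D: "\<forall>t\<in>time_dom Tm. \<forall>x. \<forall>y\<in>{0..1}. D 0 0 0 t x y = f t x y"
    and "\<forall>i j k. continuous_on (time_dom Tm \<times> UNIV \<times> {0..1}) (\<lambda>(t, x, y). D i j k t x y)"
    and "\<forall>i j k. \<forall>t\<in>time_dom Tm. \<forall>x. \<forall>y\<in>{0..1}.
        ((\<lambda>s. D i j k s x y) has_real_derivative D (Suc i) j k t x y) (at t within {0..}) \<and>
        ((\<lambda>s. D i j k t s y) has_real_derivative D i (Suc j) k t x y) (at x) \<and>
        ((\<lambda>s. D i j k t x s) has_real_derivative D i j (Suc k) t x y) (at y within {0..1})"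
    unfolding smooth_on_strip_def by blast
  then have "smooth_partials Tm D" by unfold_locales auto
  with D show thesis by (intro that[of D]) auto
qed

lemma vector_derivative_on_Icc:
  fixes f g :: "real \<Rightarrow> real"
  assumes "(g has_real_derivative d) (at y within {0..1})" and y: "y \<in> {0..1}"
    and "\<And>s. s \<in> {0..1} \<Longrightarrow> g s = f s"
  shows "vector_derivative f (at y within {0..1}) = d"
proof -
  have "(f has_real_derivative d) (at y within {0..1})"
    using assms(1) by (rule has_field_derivative_transform_within[OF _ zero_less_one y]) (rule assms(3))
  then show ?thesis
    using y vector_derivative_within_cbox[of 0 1 y f d]
    by (simp add: has_real_derivative_iff_has_vector_derivative)
qed

context smooth_partials
begin

text \<open>Since \<open>D\<close> and \<open>f\<close> agree only on the time domain, the functions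
  are exchanged within an interval \<open>{0..T}\<close> inside it, before passing to
  \<open>{0..}\<close>.\<close>

lemma dt_eq:
  assumes f: "\<And>t x y. t \<in> time_dom Tm \<Longrightarrow> y \<in> {0..1} \<Longrightarrow> D 0 0 0 t x y = f t x y"
    and t: "t \<in> time_dom Tm" and y: "y \<in> {0..1}"
  shows "dt f t x y = D (Suc 0) 0 0 t x y"
proof -
  obtain T where T: "t < T" "T \<in> time_dom Tm" using t by (rule time_dom_later)
  have t0: "0 \<le> t" using t by (simp add: time_dom_def)
  have "((\<lambda>s. f s x y) has_real_derivative D (Suc 0) 0 0 t x y) (at t within {0..T})"
  proof (rule has_field_derivative_transform_within[OF _ zero_less_one])
    show "((\<lambda>s. D 0 0 0 s x y) has_real_derivative D (Suc 0) 0 0 t x y) (at t within {0..T})"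
      by (rule has_field_derivative_subset[OF deriv_t[OF t y]]) auto
    show "D 0 0 0 s x y = f s x y" if "s \<in> {0..T}" for s
      using f[of s y x] time_dom_Icc[OF T(2)] that y by blast
  qed (use T t0 in auto)
  moreover have "at t within {0..T} = at t within {0..}"
    using T by (intro at_within_nhd[of t "{..<T}"]) auto
  ultimately show ?thesis
    unfolding dt_def using vector_derivative_within_cbox[of 0 T t "\<lambda>s. f s x y"] t0 T
    by (simp add: has_real_derivative_iff_has_vector_derivative)
qed

lemma dx_eq:
  assumes f: "\<And>x. D i j k t x y = f x y"
    and t: "t \<in> time_dom Tm" and y: "y \<in> {0..1}"
  shows "dx f x y = D i (Suc j) k t x y"
  unfolding dx_def using deriv_x[OF t y, of i j k x] by (intro DERIV_imp_deriv) (simp add: f)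

lemma dy_eq:
  assumes f: "\<And>y. y \<in> {0..1} \<Longrightarrow> D i j k t x y = f x y"
    and t: "t \<in> time_dom Tm" and y: "y \<in> {0..1}"
  shows "dy f x y = D i j (Suc k) t x y"
  unfolding dy_def using deriv_y[OF t y] y f by (rule vector_derivative_on_Icc)

end

section \<open>The dichotomy at the end of the lifespan\<close>

theorem theorem2p1:
  fixes u v :: "real \<Rightarrow> real \<Rightarrow> real \<Rightarrow> real"
    and p :: "real \<Rightarrow> real \<Rightarrow> real"
    and u0 :: "real \<Rightarrow> real \<Rightarrow> real"
    and Tm :: ereal
    and xh uh :: real
  assumes "0 < Tm"
    and "hydrostatic_euler Tm u v p"
    and maximal: "\<And>S. Tm = ereal S \<Longrightarrow> \<not> extends_beyond S u v"
    and continuation: "\<And>S. Tm = ereal S \<Longrightarrow> continuable_if_controlled S u v p xh"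
    and "\<forall>x. \<forall>y\<in>{0..1}. u 0 x y = u0 x y"
    and "\<forall>y\<in>{0..1}. u0 xh y = uh"
    and "dx (dy u0) xh 0 = 0"
    and "\<forall>y\<in>{0<..<1}. dx (dy (dy u0)) xh y < 0"
  shows "\<exists>T::real. 0 < T \<and> ereal T \<le> Tm \<and>
    (norms_blow_up T u p \<or>
     (\<exists>X Y. characteristic (ereal T) u v xh 1 X Y \<and>
        filterlim (\<lambda>t. dx (u t) (X t) 1) at_bot (at_left T)))"
proof -
  note hyps = assms
  have smooth: "smooth_on_strip Tm u" "smooth_on_strip Tm v" "smooth_on_strip Tm (\<lambda>t x y. p t x)"
    and euler: "\<And>t x y. t \<in> time_dom Tm \<Longrightarrow> y \<in> {0..1} \<Longrightarrow>
      dt u t x y + u t x y * dx (u t) x y + v t x y * dy (u t) x y = - deriv (p t) x \<and>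
      dx (u t) x y + dy (v t) x y = 0"
    and bdry: "\<And>t x. t \<in> time_dom Tm \<Longrightarrow> v t x 0 = 0 \<and> v t x 1 = 0"
    using \<open>hydrostatic_euler Tm u v p\<close> unfolding hydrostatic_euler_def by auto
  obtain U where "smooth_partials Tm U"
    and U: "\<And>t x y. t \<in> time_dom Tm \<Longrightarrow> y \<in> {0..1} \<Longrightarrow> U 0 0 0 t x y = u t x y"
    using smooth_on_strip_partials[OF smooth(1)] by metis
  obtain V where "smooth_partials Tm V"
    and V: "\<And>t x y. t \<in> time_dom Tm \<Longrightarrow> y \<in> {0..1} \<Longrightarrow> V 0 0 0 t x y = v t x y"
    using smooth_on_strip_partials[OF smooth(2)] by metis
  obtain P where "smooth_partials Tm P"
    and P: "\<And>t x y. t \<in> time_dom Tm \<Longrightarrow> y \<in> {0..1} \<Longrightarrow> P 0 0 0 t x y = p t x"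
    using smooth_on_strip_partials[OF smooth(3)] by metis
  interpret U: smooth_partials Tm U by fact
  interpret V: smooth_partials Tm V by fact
  interpret P: smooth_partials Tm P by fact
  have ux: "dx (u t) x y = U 0 (Suc 0) 0 t x y" if "t \<in> time_dom Tm" "y \<in> {0..1}" for t x y
    using that by (intro U.dx_eq U)
  have uy: "dy (u t) x y = U 0 0 (Suc 0) t x y" if "t \<in> time_dom Tm" "y \<in> {0..1}" for t x y
    using that by (intro U.dy_eq U)
  have vy: "dy (v t) x y = V 0 0 (Suc 0) t x y" if "t \<in> time_dom Tm" "y \<in> {0..1}" for t x y
    using that by (intro V.dy_eq V)
  have px: "deriv (p t) x = P 0 (Suc 0) 0 t x 0" if t: "t \<in> time_dom Tm" for t x
    using P.deriv_x[OF t, of 0 0 0 0 x] P[OF t, of 0] by (intro DERIV_imp_deriv) simp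
  note 0 = time_dom_0[OF \<open>0 < Tm\<close>]
  have u0: "u0 x y = U 0 0 0 0 x y" if "y \<in> {0..1}" for x y
    using hyps(5) U[OF 0 that] that by simp
  have u0y: "dy u0 x y = U 0 0 (Suc 0) 0 x y" if "y \<in> {0..1}" for x y
    by (rule U.dy_eq) (use u0 0 that in auto)
  have u0yy: "dy (dy u0) x y = U 0 0 (Suc (Suc 0)) 0 x y" if "y \<in> {0..1}" for x y
    by (rule U.dy_eq) (use u0y 0 that in auto)
  have u0xy: "dx (dy u0) x y = U 0 (Suc 0) (Suc 0) 0 x y" if "y \<in> {0..1}" for x y
    by (rule U.dx_eq) (use u0y 0 that in auto)
  have u0xyy: "dx (dy (dy u0)) x y = U 0 (Suc 0) (Suc (Suc 0)) 0 x y" if "y \<in> {0..1}" for x y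
    by (rule U.dx_eq) (use u0yy 0 that in auto)
  interpret hydrostatic_column Tm U V P xh uh
  proof
    fix t x y
    assume t: "t \<in> time_dom Tm"
    show "V 0 0 0 t x 0 = 0" "V 0 0 0 t x 1 = 0"
      using bdry[OF t] by (simp_all add: V[OF t])
    assume y: "y \<in> {0..(1::real)}"
    show "U (Suc 0) 0 0 t x y + U 0 0 0 t x y * U 0 (Suc 0) 0 t x y
        + V 0 0 0 t x y * U 0 0 (Suc 0) t x y = - P 0 (Suc 0) 0 t x 0"
      using euler[OF t y, of x] U.dt_eq[OF U t y, of x] px[OF t, of x]
      by (simp add: U[OF t y] V[OF t y] ux[OF t y] uy[OF t y])
    show "U 0 (Suc 0) 0 t x y + V 0 0 (Suc 0) t x y = 0"
      using euler[OF t y, of x] by (simp add: ux[OF t y] vy[OF t y])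
  next
    show "0 < Tm" by fact
    show "U 0 0 0 0 xh y = uh" if "y \<in> {0..1}" for y
      using that hyps(6) u0 by metis
    show "U 0 (Suc 0) (Suc 0) 0 xh 0 = 0"
      using hyps(7) u0xy[of 0] by simp
    show "U 0 (Suc 0) (Suc (Suc 0)) 0 xh y < 0" if "y \<in> {0<..<1}" for y
      using bspec[OF hyps(8) that] u0xyy[of y xh] that by simp
  qed
  \<comment> \<open>An infinite lifespan would contain the time \<open>3 / m 0\<close>,
    contradicting \<open>lifespan_less\<close>.\<close>
  obtain S where S: "Tm = ereal S"
  proof (cases Tm)
    case PInf
    then have "3 / m 0 \<in> time_dom Tm" using m_0_pos by (simp add: time_dom_def)
    from lifespan_less[OF this] show thesis by simp
  qed (use \<open>0 < Tm\<close> that in auto)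
  have S0: "0 < S" using \<open>0 < Tm\<close> S by (simp add: zero_ereal_def)
  have dom: "t \<in> time_dom Tm \<longleftrightarrow> 0 \<le> t \<and> t < S" for t
    by (simp add: time_dom_def S)
  show ?thesis
  proof (intro exI conjI)
    show "0 < S" by fact
    show "ereal S \<le> Tm" by (simp add: S)
    \<comment> \<open>The characteristic stays at height 1 because \<open>v\<close> vanishes there,
      and moves with velocity \<open>c\<close> by \<open>u_column\<close>.\<close>
    have char: "characteristic (ereal S) u v xh 1 X (\<lambda>_. 1)"
      unfolding characteristic_def
      using deriv_X u_column[of _ 1] U[of _ 1] bdry by (auto simp: X_0 S)
    have "filterlim (\<lambda>t. dx (u t) (X t) 1) at_bot (at_left S)" if "\<not> norms_blow_up S u p"
    proof -
      \<comment> \<open>The solution cannot be extended beyond \<open>S\<close>, so the continuation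
        convention leaves loss of gradient control as the only cause.\<close>
      have unbounded: "\<not> gradient_bounded_from S u v xh"
        using maximal[OF S] continuation[OF S] that unfolding continuable_if_controlled_def by blast
      \<comment> \<open>A bound on \<open>m\<close> would control the gradient on the column:
        \<open>ux\<close> by \<open>ux_column_le_m\<close>, while \<open>uy\<close> vanishes
        there.\<close>
      have ex: "\<exists>t\<in>{0..<S}. B < m t" for B
      proof (rule ccontr)
        assume "\<not> (\<exists>t\<in>{0..<S}. B < m t)"
        then have B: "m t \<le> B" if "t \<in> time_dom Tm" for t
          using that by (auto simp: dom not_less)
        have "gradient_bounded_from S u v xh"
          unfolding gradient_bounded_from_def
        proof (intro exI ballI allI impI)
          fix y0 s X' Y' t
          assume s: "s \<in> {0<..S}" and char: "characteristic (ereal s) u v xh y0 X' Y'"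
            and t: "t \<in> {0..<s}"
          have char': "Y' r \<in> {0..1} \<and> (X' has_real_derivative U 0 0 0 r (X' r) (Y' r)) (at r within {0..})"
            if "r \<in> time_dom (ereal s)" for r
          proof -
            have "r \<in> time_dom Tm" using that s by (auto simp: time_dom_def S)
            then show ?thesis using char that U unfolding characteristic_def by auto
          qed
          have ts: "t \<in> time_dom (ereal s)" using t by (simp add: time_dom_def)
          have tT: "t \<in> time_dom Tm" using t s by (simp add: dom)
          have "X' t = X t"
            using char s ts by (intro characteristic_eq[where s = s and Y' = Y'] char')
              (auto simp: characteristic_def S)
          moreover have Y: "Y' t \<in> {0..1}" using char'[OF ts] by blast
          ultimately have "dx (u t) (X' t) (Y' t) = U 0 (Suc 0) 0 t (X t) (Y' t)"
            "dy (u t) (X' t) (Y' t) = 0"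
            by (simp_all only: ux[OF tT Y] uy[OF tT Y] uy_column[OF tT Y])
          moreover have "\<bar>U 0 (Suc 0) 0 t (X t) (Y' t)\<bar> \<le> B"
            using ux_column_le_m[OF tT Y] B[OF tT] by linarith
          ultimately show "\<bar>dx (u t) (X' t) (Y' t)\<bar> \<le> B \<and> \<bar>dy (u t) (X' t) (Y' t)\<bar> \<le> B"
            by auto
        qed
        with unbounded show False ..
      qed
      \<comment> \<open>Monotonicity of \<open>m\<close> turns unboundedness into a limit.\<close>
      show ?thesis
        unfolding filterlim_at_bot
      proof
        fix Z :: real
        obtain t where t: "t \<in> {0..<S}" "- Z < m t" using ex by blast
        have "dx (u r) (X r) 1 \<le> Z" if r: "r \<in> {t<..<S}" for r
        proof -
          have rT: "r \<in> time_dom Tm" using r t by (simp add: dom)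
          have "m t \<le> m r" using r t by (intro m_mono rT) auto
          then show ?thesis using t(2) ux[OF rT, of 1] by (simp add: m_def)
        qed
        then show "\<forall>\<^sub>F r in at_left S. dx (u r) (X r) 1 \<le> Z"
          using t by (intro eventually_at_leftI[of t]) auto
      qed
    qed
    then show "norms_blow_up S u p \<or> (\<exists>X Y. characteristic (ereal S) u v xh 1 X Y \<and>
        filterlim (\<lambda>t. dx (u t) (X t) 1) at_bot (at_left S))"
      using char by blast
  qed
qed

end
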